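(* There exist a universal constant $C>0$ and an integer $d_0$ such that, for every integer $d\ge d_0$ and every integer $T\ge C\,d\log d$, an ORA walk $Q_T\in O(d)$ of length $T$ satisfies, with probability at least $1-d^{-2}$, $$\|Q_T\|_\infty\le 8\sqrt{\frac{\log d}{d}}.$$
   Context: $O(d)$ denotes the group of real orthogonal $d\times d$ matrices. For a real matrix $M$, $\|M\|_\infty=\max_{i,j}|M_{ij}|$ is the maximal absolute entry. For an ordered pair $(i,j)$ of distinct coordinates in $[d]=\{1,\dots,d\}$, let $R_{ij}\in O(d)$ be the rotation by angle $\pi/4$ acting on the coordinates $(x_i,x_j)$ by the matrix $\frac1{\sqrt2}\begin{pmatrix}1&-1\\1&1\end{pmatrix}$ and leaving all other coordinates unchanged. An ORA (orthogonal repeated averaging) update chooses an ordered pair $(i,j)$, $i\ne j$, uniformly from the $d(d-1)$ ordered pairs of distinct coordinates and applies $R_{ij}$. An ORA walk of length $T$ is the random matrix $Q_T=R_{i_Tj_T}\cdots R_{i_1j_1}$, the product of $T$ independent ORA updates. *)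

theory Defs
  imports "HOL-Probability.Probability" "Jordan_Normal_Form.Matrix"
begin

text \<open>The dimension \<open>d\<close> is quantified inside the theorem, so matrices are elements of
  \<^term>\<open>carrier_mat d d\<close>; coordinates are numbered \<open>0, \<dots>, d - 1\<close>.\<close>

definition orthogonal_group :: "nat \<Rightarrow> real mat set" where
  "orthogonal_group d = {A \<in> carrier_mat d d. transpose_mat A * A = 1\<^sub>m d}"

definition coord_pairs :: "nat \<Rightarrow> (nat \<times> nat) set" where
  "coord_pairs d = {(i, j). i < d \<and> j < d \<and> i \<noteq> j}"

definition ora_rotation :: "nat \<Rightarrow> nat \<Rightarrow> nat \<Rightarrow> real mat" where
  "ora_rotation d i j = mat d d (\<lambda>(k, l).
     if k = i \<and> l = i then 1 / sqrt 2
     else if k = i \<and> l = j then - 1 / sqrt 2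
     else if k = j \<and> l = i then 1 / sqrt 2
     else if k = j \<and> l = j then 1 / sqrt 2
     else if k = l then 1 else 0)"

text \<open>The head of the list is the first update, i.e. the rightmost factor of the product.\<close>

definition ora_product :: "nat \<Rightarrow> (nat \<times> nat) list \<Rightarrow> real mat" where
  "ora_product d ps = fold (\<lambda>(i, j) Q. ora_rotation d i j * Q) ps (1\<^sub>m d)"

text \<open>The law of \<open>Q\<^sub>T\<close>. This is meaningful for \<open>d \<ge> 2\<close>: otherwise \<^term>\<open>coord_pairs d\<close>
  is empty and \<^term>\<open>pmf_of_set\<close> is unspecified.\<close>

definition ora_walk :: "nat \<Rightarrow> nat \<Rightarrow> real mat pmf" where
  "ora_walk d T = map_pmf (ora_product d) (replicate_pmf T (pmf_of_set (coord_pairs d)))"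

definition max_abs_entry :: "real mat \<Rightarrow> real" where
  "max_abs_entry M = Max {\<bar>M $$ (i, j)\<bar> | i j. i < dim_row M \<and> j < dim_col M}"

lemma finite_coord_pairs: "finite (coord_pairs d)"
  by (rule finite_subset[of _ "{..<d} \<times> {..<d}"]) (auto simp: coord_pairs_def)

lemma coord_pairs_nonempty:
  assumes "d \<ge> 2"
  shows "coord_pairs d \<noteq> {}"
proof -
  have "(0, 1) \<in> coord_pairs d" using assms by (simp add: coord_pairs_def)
  then show ?thesis by blast
qed

lemma card_coord_pairs: "card (coord_pairs d) = d * (d - 1)"
proof -
  have "coord_pairs d = (SIGMA i:{..<d}. {..<d} - {i})" by (auto simp: coord_pairs_def)
  then show ?thesis by simp
qed

lemma ora_rotation_orthogonal:
  assumes "(i, j) \<in> coord_pairs d"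
  shows "ora_rotation d i j \<in> orthogonal_group d"
proof -
  let ?R = "ora_rotation d i j"
  have ij: "i < d" "j < d" "i \<noteq> j" using assms by (auto simp: coord_pairs_def)
  have c: "?R \<in> carrier_mat d d" by (simp add: ora_rotation_def)
  have "transpose_mat ?R * ?R = 1\<^sub>m d"
  proof (rule eq_matI)
    fix a b assume "a < dim_row (1\<^sub>m d :: real mat)" "b < dim_col (1\<^sub>m d :: real mat)"
    then have ab: "a < d" "b < d" by auto
    let ?f = "\<lambda>k. ?R $$ (k, a) * ?R $$ (k, b)"
    have "(transpose_mat ?R * ?R) $$ (a, b) = (\<Sum>k\<in>{0..<d}. ?f k)"
      using ab c by (simp add: scalar_prod_def)
    also have "\<dots> = ?f i + ?f j + (\<Sum>k\<in>{0..<d} - {i} - {j}. ?f k)"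
      using ij by (simp add: sum.remove[of "{0..<d}" i] sum.remove[of "{0..<d} - {i}" j])
    also have "(\<Sum>k\<in>{0..<d} - {i} - {j}. ?f k)
        = (\<Sum>k\<in>{0..<d} - {i} - {j}. if k = a then (if a = b then 1 else 0) else 0)"
      using ij ab by (intro sum.cong) (auto simp: ora_rotation_def)
    also have "\<dots> = (if a \<noteq> i \<and> a \<noteq> j \<and> a = b then 1 else 0)"
      using ab by (auto simp: sum.delta)
    also have "?f i + ?f j + \<dots> = 1\<^sub>m d $$ (a, b)"
      using ij ab by (auto simp: ora_rotation_def)
    finally show "(transpose_mat ?R * ?R) $$ (a, b) = 1\<^sub>m d $$ (a, b)" .
  qed (use c in auto)
  with c show ?thesis by (simp add: orthogonal_group_def)
qed

lemma orthogonal_group_mult: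
  assumes "A \<in> orthogonal_group d" "B \<in> orthogonal_group d"
  shows "A * B \<in> orthogonal_group d"
proof -
  have c: "A \<in> carrier_mat d d" "B \<in> carrier_mat d d"
    and o: "transpose_mat A * A = 1\<^sub>m d" "transpose_mat B * B = 1\<^sub>m d"
    using assms by (auto simp: orthogonal_group_def)
  have "transpose_mat (A * B) * (A * B) = transpose_mat B * (transpose_mat A * (A * B))"
    using c by (simp add: transpose_mult[OF c] assoc_mult_mat[of _ d d _ d _ d])
  also have "transpose_mat A * (A * B) = (transpose_mat A * A) * B"
    using c by (simp add: assoc_mult_mat[of _ d d _ d _ d])
  finally show ?thesis using c o by (simp add: orthogonal_group_def)
qed

lemma ora_walk_orthogonal:
  assumes "d \<ge> 2" "Q \<in> set_pmf (ora_walk d T)"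
  shows "Q \<in> orthogonal_group d"
proof -
  have gen: "fold (\<lambda>(i, j) Q. ora_rotation d i j * Q) ps A \<in> orthogonal_group d"
    if "set ps \<subseteq> coord_pairs d" "A \<in> orthogonal_group d" for ps A
    using that
  proof (induction ps arbitrary: A)
    case (Cons p ps)
    then show ?case
      by (cases p) (auto intro!: Cons.IH orthogonal_group_mult ora_rotation_orthogonal)
  qed simp
  obtain ps where "set ps \<subseteq> coord_pairs d" "Q = ora_product d ps"
    using assms
    by (auto simp: ora_walk_def set_replicate_pmf set_pmf_of_set finite_coord_pairs
        coord_pairs_nonempty)
  moreover have "1\<^sub>m d \<in> orthogonal_group d" by (simp add: orthogonal_group_def)
  ultimately show ?thesis by (simp add: ora_product_def gen)
qed

end

theory Submission
  imports Defs "HOL-Real_Asymp.Real_Asymp"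
begin

text \<open>Split the walk into two halves. By duality an entry of \<open>Q\<^sub>T\<close> is \<open>\<langle>v, x\<rangle>\<close> for two independent walks
  \<open>v\<close>, \<open>x\<close> started at basis vectors, and since the law of an update is invariant under conjugation by
  diagonal sign matrices, the coordinates of \<open>x\<close> may be given independent random signs. Hence
  \<open>P(\<bar>\<langle>v, x\<rangle>\<bar> > b) \<le> 2 exp (- c b) E exp (c\<^sup>2 \<Sum> v\<^sub>i\<^sup>2 x\<^sub>i\<^sup>2 / 2)\<close>, and AM-GM separates \<open>v\<close> from \<open>x\<close>, so it
  suffices to bound the exponential moments of \<open>\<Sum> x\<^sub>i\<^sup>4\<close>, which drifts towards \<open>3 / d\<close> at rate \<open>1 / d\<close>.
  This works as long as all \<open>x\<^sub>i\<^sup>2\<close> stay below \<open>d powr (- 5 / 8)\<close>, which holds after \<open>O(d log d)\<close> steps up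
  to probability \<open>O(d\<^bsup>-8\<^esup>)\<close> because \<open>E \<Sum> x\<^sub>i\<^bsup>48\<^esup> = O(d\<^bsup>-23\<^esup>)\<close>, a bound obtained from a linear recursion
  relating consecutive even moments. With \<open>c = 2 sqrt (d log d)\<close> and \<open>b = 8 sqrt (log d / d)\<close> each entry
  exceeds \<open>b\<close> with probability at most \<open>d\<^bsup>-4\<^esup>\<close>.\<close>

subsection \<open>The averaging operator\<close>

text \<open>The action of \<open>ora_rotation\<close> on column vectors. Vectors are total
  functions, so the dimension enters only through sums over \<open>{..<d}\<close> and no carrier
  conditions arise.\<close>

definition rot :: "nat \<times> nat \<Rightarrow> (nat \<Rightarrow> real) \<Rightarrow> nat \<Rightarrow> real" where
  "rot p x = (\<lambda>k. if k = fst p then (x (fst p) - x (snd p)) / sqrt 2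
     else if k = snd p then (x (fst p) + x (snd p)) / sqrt 2 else x k)"

text \<open>The transition operator of the walk on vectors: its iterates give the expectation of
  \<open>f\<close> after several updates started at \<open>x\<close>. As a finite sum it is handled
  by algebra alone, and the link to probability is made only in
  \<open>expectation_walk\<close>.\<close>

definition avg :: "nat \<Rightarrow> ((nat \<Rightarrow> real) \<Rightarrow> real) \<Rightarrow> (nat \<Rightarrow> real) \<Rightarrow> real" where
  "avg d f x = (\<Sum>p\<in>coord_pairs d. f (rot p x)) / (real d * (real d - 1))"

text \<open>The index \<open>p\<close> is half the exponent: \<open>power_sum d 2\<close> is the sum
  of fourth powers.\<close>

definition power_sum :: "nat \<Rightarrow> nat \<Rightarrow> (nat \<Rightarrow> real) \<Rightarrow> real" where
  "power_sum d p x = (\<Sum>i<d. ((x i)\<^sup>2) ^ p)"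

definition unit_sphere :: "nat \<Rightarrow> (nat \<Rightarrow> real) set" where
  "unit_sphere d = {x. power_sum d 1 x = 1}"

lemma sum_two:
  fixes g :: "nat \<Rightarrow> 'a::comm_monoid_add"
  assumes "(i, j) \<in> coord_pairs d"
  shows "(\<Sum>k<d. g k) = g i + (g j + (\<Sum>k\<in>{..<d} - {i} - {j}. g k))"
  using assms unfolding coord_pairs_def
  by (simp add: sum.remove[of "{..<d}" i] sum.remove[of "{..<d} - {i}" j])

lemma power_sum_rot:
  assumes "(i, j) \<in> coord_pairs d"
  shows "power_sum d p (rot (i, j) x) = power_sum d p x - ((x i)\<^sup>2) ^ p - ((x j)\<^sup>2) ^ p
    + ((x i - x j)\<^sup>2 / 2) ^ p + ((x i + x j)\<^sup>2 / 2) ^ p"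
proof -
  have "i \<noteq> j" using assms by (auto simp: coord_pairs_def)
  have "(\<Sum>k\<in>{..<d} - {i} - {j}. ((rot (i, j) x k)\<^sup>2) ^ p) = (\<Sum>k\<in>{..<d} - {i} - {j}. ((x k)\<^sup>2) ^ p)"
    by (intro sum.cong) (auto simp: rot_def)
  then show ?thesis
    using \<open>i \<noteq> j\<close> unfolding power_sum_def sum_two[OF assms]
    by (simp add: rot_def power_divide)
qed

lemma rot_unit_sphere:
  assumes "p \<in> coord_pairs d" "x \<in> unit_sphere d"
  shows "rot p x \<in> unit_sphere d"
proof -
  obtain i j where p: "p = (i, j)" by force
  show ?thesis
    using assms power_sum_rot[of i j d 1 x] unfolding p unit_sphere_def
    by (simp add: power2_eq_square field_simps)
qed

lemma sum_coord_pairs: "(\<Sum>p\<in>coord_pairs d. g p) = (\<Sum>i<d. \<Sum>j\<in>{..<d} - {i}. g (i, j))"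
proof -
  have "coord_pairs d = (SIGMA i:{..<d}. {..<d} - {i})" by (auto simp: coord_pairs_def)
  then show ?thesis by (simp add: sum.Sigma split_beta)
qed

lemma sum_coord_pairs_swap:
  "(\<Sum>p\<in>coord_pairs d. g (snd p, fst p)) = (\<Sum>p\<in>coord_pairs d. g p)"
  by (rule sum.reindex_bij_witness[of _ "\<lambda>p. (snd p, fst p)" "\<lambda>p. (snd p, fst p)"])
    (auto simp: coord_pairs_def)

lemma sum_coord_pairs_fst:
  "(\<Sum>p\<in>coord_pairs d. g (fst p)) = (real d - 1) * (\<Sum>i<d. g i :: real)"
  unfolding sum_coord_pairs by (auto simp: sum_distrib_left of_nat_diff intro!: sum.cong)

lemma sum_coord_pairs_snd:
  "(\<Sum>p\<in>coord_pairs d. g (snd p)) = (real d - 1) * (\<Sum>i<d. g i :: real)"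
  using sum_coord_pairs_swap[of "\<lambda>p. g (snd p)" d] by (simp add: sum_coord_pairs_fst)

text \<open>The product on the right also contains the diagonal terms \<open>g i * h i\<close>,
  which are nonnegative.\<close>

lemma sum_coord_pairs_mult_le:
  fixes g h :: "nat \<Rightarrow> real"
  assumes "\<And>i. g i \<ge> 0" "\<And>i. h i \<ge> 0"
  shows "(\<Sum>p\<in>coord_pairs d. g (fst p) * h (snd p)) \<le> (\<Sum>i<d. g i) * (\<Sum>j<d. h j)"
  unfolding sum_coord_pairs sum_product fst_conv snd_conv
  using assms by (intro sum_mono sum_mono2) auto

section \<open>Monotonicity and linearity of the transition operator and its iterates\<close>

text \<open>Updates preserve the sphere, so a comparison of \<open>f\<close> and \<open>g\<close> is
  needed only there.\<close>

lemma avg_mono: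
  assumes "d \<ge> 2" "\<And>x. x \<in> unit_sphere d \<Longrightarrow> f x \<le> g x" "x \<in> unit_sphere d"
  shows "avg d f x \<le> avg d g x"
  unfolding avg_def using assms
  by (intro divide_right_mono sum_mono) (auto intro: rot_unit_sphere)

lemma avg_pow_mono:
  assumes "d \<ge> 2" "\<And>x. x \<in> unit_sphere d \<Longrightarrow> f x \<le> g x" "x \<in> unit_sphere d"
  shows "(avg d ^^ n) f x \<le> (avg d ^^ n) g x"
  using assms(3)
  by (induction n arbitrary: x) (auto intro: avg_mono assms)

lemma avg_const: "d \<ge> 2 \<Longrightarrow> avg d (\<lambda>_. c) = (\<lambda>_. c)"
  by (auto simp: avg_def card_coord_pairs of_nat_diff fun_eq_iff)

lemma avg_add: "avg d (\<lambda>x. f x + g x) = (\<lambda>x. avg d f x + avg d g x)"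
  by (simp add: avg_def sum.distrib add_divide_distrib fun_eq_iff)

lemma avg_cmult: "avg d (\<lambda>x. c * f x) = (\<lambda>x. c * avg d f x)"
  by (simp add: avg_def sum_distrib_left fun_eq_iff)

lemma avg_sum: "avg d (\<lambda>x. \<Sum>i\<in>I. f i x) = (\<lambda>x. \<Sum>i\<in>I. avg d (f i) x)"
  unfolding avg_def fun_eq_iff by (subst sum.swap) (simp add: sum_divide_distrib)

lemma avg_pow_const: "d \<ge> 2 \<Longrightarrow> (avg d ^^ n) (\<lambda>_. c) = (\<lambda>_. c)"
  by (induction n) (auto simp: avg_const)

lemma avg_pow_add: "(avg d ^^ n) (\<lambda>x. f x + g x) = (\<lambda>x. (avg d ^^ n) f x + (avg d ^^ n) g x)"
  by (induction n) (simp_all add: avg_add)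

lemma avg_pow_cmult: "(avg d ^^ n) (\<lambda>x. c * f x) = (\<lambda>x. c * (avg d ^^ n) f x)"
  by (induction n) (simp_all add: avg_cmult)

lemma avg_pow_sum: "(avg d ^^ n) (\<lambda>x. \<Sum>i\<in>I. f i x) = (\<lambda>x. \<Sum>i\<in>I. (avg d ^^ n) (f i) x)"
  by (induction n) (simp_all add: avg_sum)

section \<open>Recursion between consecutive even moments, and their decay\<close>

text \<open>With \<open>r = (a + b)\<^sup>2 / 2\<close> and \<open>s = (a - b)\<^sup>2 / 2\<close> one has \<open>r + s = u + v\<close>, so that
  \<open>r ^ p + s ^ p \<le> (r\<^sup>2 + s\<^sup>2) (u + v) ^ (p - 2)\<close>. The coefficient \<open>1 / 2\<close> of the pure powers,
  being smaller than 1, makes the moments contract.\<close>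

lemma rotated_power_le:
  fixes a b :: real
  defines "u \<equiv> a\<^sup>2" and "v \<equiv> b\<^sup>2"
  shows "((a - b)\<^sup>2 / 2) ^ (q + 2) + ((a + b)\<^sup>2 / 2) ^ (q + 2)
    \<le> (u ^ (q + 2) + v ^ (q + 2)) / 2 + 2 ^ (q + 1) * (u * v ^ (q + 1) + u ^ (q + 1) * v)"
proof -
  define r s where "r = (a + b)\<^sup>2 / 2" and "s = (a - b)\<^sup>2 / 2"
  have nn: "r \<ge> 0" "s \<ge> 0" "u \<ge> 0" "v \<ge> 0" by (auto simp: r_def s_def u_def v_def)
  have rs: "r + s = u + v" "r\<^sup>2 + s\<^sup>2 = (u\<^sup>2 + v\<^sup>2) / 2 + 3 * u * v"
    by (auto simp: r_def s_def u_def v_def power2_eq_square field_simps)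
  have "s ^ (q + 2) + r ^ (q + 2) \<le> (r\<^sup>2 + s\<^sup>2) * (u + v) ^ q"
  proof -
    have "s ^ q \<le> (u + v) ^ q" "r ^ q \<le> (u + v) ^ q"
      using nn by (auto simp: rs[symmetric] intro!: power_mono)
    then have "s\<^sup>2 * s ^ q + r\<^sup>2 * r ^ q \<le> s\<^sup>2 * (u + v) ^ q + r\<^sup>2 * (u + v) ^ q"
      by (intro add_mono mult_left_mono) auto
    then show ?thesis by (simp add: power_add algebra_simps power2_eq_square)
  qed
  also have "\<dots> = ((u\<^sup>2 + v\<^sup>2) / 2 + 3 * u * v) * (u + v) ^ q" by (simp add: rs)
  \<comment> \<open>The coefficient \<open>K = 2 ^ (q + 1) - 1 / 2\<close> is exact for
    \<open>q = 0\<close>, and each induction step turns \<open>K\<close> into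
    \<open>2 * K + 1 / 2\<close>, which is the same expression at \<open>q + 1\<close>.\<close>
  also have "\<dots> \<le> (u ^ (q + 2) + v ^ (q + 2)) / 2
      + (2 ^ (q + 1) - 1 / 2) * (u * v ^ (q + 1) + u ^ (q + 1) * v)"
  proof (induction q)
    case 0
    show ?case by (simp add: power2_eq_square algebra_simps)
  next
    case (Suc q)
    let ?K = "2 ^ (q + 1) - 1 / 2 :: real"
    have K: "?K \<ge> 0" using one_le_power[of "2::real" "q + 1"] by linarith
    \<comment> \<open>\<open>u - v\<close> and \<open>u ^ q - v ^ q\<close> have the same sign; this
      moves the mixed terms to the extreme ones with a single factor \<open>u\<close> or
      \<open>v\<close>.\<close>
    have "0 \<le> (u * v) * ((u - v) * (u ^ q - v ^ q))"
    proof (cases "u \<le> v")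
      case True
      then have "u ^ q \<le> v ^ q" using nn by (intro power_mono) auto
      then show ?thesis using True nn by (intro mult_nonneg_nonneg mult_nonpos_nonpos) auto
    next
      case False
      then have "v ^ q \<le> u ^ q" using nn by (intro power_mono) auto
      then show ?thesis using False nn by (intro mult_nonneg_nonneg) auto
    qed
    then have cross: "u\<^sup>2 * v ^ (q + 1) + u ^ (q + 1) * v\<^sup>2 \<le> u * v ^ (q + 2) + u ^ (q + 2) * v"
      by (simp add: algebra_simps power2_eq_square)
    have "((u\<^sup>2 + v\<^sup>2) / 2 + 3 * u * v) * (u + v) ^ Suc q
        = (((u\<^sup>2 + v\<^sup>2) / 2 + 3 * u * v) * (u + v) ^ q) * (u + v)" by simp
    also have "\<dots> \<le> ((u ^ (q + 2) + v ^ (q + 2)) / 2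
        + ?K * (u * v ^ (q + 1) + u ^ (q + 1) * v)) * (u + v)"
      using nn by (intro mult_right_mono Suc) auto
    also have "\<dots> = (u ^ (q + 3) + v ^ (q + 3)) / 2 + (?K + 1 / 2) * (u * v ^ (q + 2) + u ^ (q + 2) * v)
        + ?K * (u\<^sup>2 * v ^ (q + 1) + u ^ (q + 1) * v\<^sup>2)"
    proof -
      have *: "u ^ (q + 3) = u * u * u * u ^ q" "v ^ (q + 3) = v * v * v * v ^ q"
        "u ^ (q + 2) = u * u * u ^ q" "v ^ (q + 2) = v * v * v ^ q"
        "u ^ (q + 1) = u * u ^ q" "v ^ (q + 1) = v * v ^ q"
        by (simp_all add: power_add power2_eq_square power3_eq_cube)
      show ?thesis unfolding * power2_eq_square
        by (simp add: field_simps)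
    qed
    also have "\<dots> \<le> (u ^ (q + 3) + v ^ (q + 3)) / 2 + (?K + 1 / 2) * (u * v ^ (q + 2) + u ^ (q + 2) * v)
        + ?K * (u * v ^ (q + 2) + u ^ (q + 2) * v)"
      by (intro add_left_mono mult_left_mono cross K)
    also have "\<dots> = (u ^ (Suc q + 2) + v ^ (Suc q + 2)) / 2
      + (2 ^ (Suc q + 1) - 1 / 2) * (u * v ^ (Suc q + 1) + u ^ (Suc q + 1) * v)"
      by (simp add: eval_nat_numeral algebra_simps)
    finally show ?case .
  qed
  also have "\<dots> \<le> (u ^ (q + 2) + v ^ (q + 2)) / 2 + 2 ^ (q + 1) * (u * v ^ (q + 1) + u ^ (q + 1) * v)"
    using nn by (intro add_left_mono mult_right_mono) auto
  finally show ?thesis by (simp add: r_def s_def)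
qed

text \<open>Summation of \<open>rotated_power_le\<close> over all pairs. Every coordinate occurs in
  \<open>2 * (d - 1)\<close> ordered pairs and loses half of its pure power in each, hence the
  factor \<open>1 - 1 / d\<close>. In the cross terms one factor sums to at most 1 on the
  sphere.\<close>

lemma avg_power_sum_le:
  assumes d: "d \<ge> 2" and x: "x \<in> unit_sphere d"
  shows "avg d (power_sum d (q + 2)) x \<le> (1 - 1 / real d) * power_sum d (q + 2) x
    + 2 ^ (q + 2) / (real d * (real d - 1)) * power_sum d (q + 1) x"
proof -
  define N where "N = real d * (real d - 1)"
  have N: "N > 0" using d by (simp add: N_def)
  define u where "u i = (x i)\<^sup>2" for i
  have u0: "u i \<ge> 0" for i by (simp add: u_def)
  have S1: "(\<Sum>i<d. u i) = 1" using x by (simp add: unit_sphere_def power_sum_def u_def)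
  have S: "power_sum d p x = (\<Sum>i<d. u i ^ p)" for p by (simp add: power_sum_def u_def)
  have "(\<Sum>p\<in>coord_pairs d. power_sum d (q + 2) (rot p x))
      \<le> (\<Sum>p\<in>coord_pairs d. power_sum d (q + 2) x - (u (fst p) ^ (q + 2)) / 2
         - (u (snd p) ^ (q + 2)) / 2
         + 2 ^ (q + 1) * (u (fst p) * u (snd p) ^ (q + 1) + u (fst p) ^ (q + 1) * u (snd p)))"
  proof (intro sum_mono)
    fix p assume p: "p \<in> coord_pairs d"
    obtain i j where ij: "p = (i, j)" by force
    show "power_sum d (q + 2) (rot p x) \<le> power_sum d (q + 2) x - (u (fst p) ^ (q + 2)) / 2
         - (u (snd p) ^ (q + 2)) / 2
         + 2 ^ (q + 1) * (u (fst p) * u (snd p) ^ (q + 1) + u (fst p) ^ (q + 1) * u (snd p))"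
      using rotated_power_le[of "x i" "x j" q] power_sum_rot[of i j d "q + 2" x] p
      unfolding ij u_def fst_conv snd_conv by argo
  qed
  also have "\<dots> = N * power_sum d (q + 2) x - (real d - 1) * power_sum d (q + 2) x
      + 2 ^ (q + 1) * ((\<Sum>p\<in>coord_pairs d. u (fst p) * u (snd p) ^ (q + 1))
        + (\<Sum>p\<in>coord_pairs d. u (fst p) ^ (q + 1) * u (snd p)))"
  proof -
    have c: "real (card (coord_pairs d)) = N"
      using d by (simp add: card_coord_pairs N_def of_nat_diff)
    show ?thesis
      unfolding sum.distrib sum_subtractf sum_constant c sum_distrib_left[symmetric]
        sum_divide_distrib[symmetric] sum_coord_pairs_fst[of "\<lambda>i. u i ^ (q + 2)"]
        sum_coord_pairs_snd[of "\<lambda>i. u i ^ (q + 2)"] S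
      by simp
  qed
  also have "\<dots> \<le> N * power_sum d (q + 2) x - (real d - 1) * power_sum d (q + 2) x
      + 2 ^ (q + 1) * (power_sum d (q + 1) x + power_sum d (q + 1) x)"
  proof (intro add_left_mono mult_left_mono add_mono)
    show "(\<Sum>p\<in>coord_pairs d. u (fst p) * u (snd p) ^ (q + 1)) \<le> power_sum d (q + 1) x"
      using sum_coord_pairs_mult_le[of u "\<lambda>i. u i ^ (q + 1)" d] u0 S1 S by simp
    show "(\<Sum>p\<in>coord_pairs d. u (fst p) ^ (q + 1) * u (snd p)) \<le> power_sum d (q + 1) x"
      using sum_coord_pairs_mult_le[of "\<lambda>i. u i ^ (q + 1)" u d] u0 S1 S by simp
  qed auto
  finally have "avg d (power_sum d (q + 2)) x \<le> (N * power_sum d (q + 2) x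
      - (real d - 1) * power_sum d (q + 2) x + 2 ^ (q + 2) * power_sum d (q + 1) x) / N"
    unfolding avg_def N_def[symmetric] using N by (intro divide_right_mono) auto
  also have "\<dots> = (1 - 1 / real d) * power_sum d (q + 2) x + 2 ^ (q + 2) / N * power_sum d (q + 1) x"
    using d by (simp add: N_def field_simps)
  finally show ?thesis by (simp add: N_def)
qed

lemma power_sum_nonneg: "power_sum d p x \<ge> 0"
  by (simp add: power_sum_def sum_nonneg)

lemma power_sum_le_one:
  assumes "x \<in> unit_sphere d" "p \<ge> 1"
  shows "power_sum d p x \<le> 1"
proof -
  have s: "(\<Sum>i<d. (x i)\<^sup>2) = 1" using assms by (simp add: unit_sphere_def power_sum_def)
  have "(x i)\<^sup>2 \<le> 1" if "i < d" for i
    using that s sum_nonneg_leq_bound[of "{..<d}" "\<lambda>i. (x i)\<^sup>2" 1 i] by auto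
  then have "((x i)\<^sup>2) ^ p \<le> (x i)\<^sup>2" if "i < d" for i
    using that power_decreasing[of 1 p "(x i)\<^sup>2"] assms by auto
  then show ?thesis unfolding power_sum_def s[symmetric] by (intro sum_mono) auto
qed

text \<open>Stagewise relaxation: \<open>\<tau>\<close> further steps bring each next moment down to
  its stationary order \<open>d ^ (- q)\<close>. In the recursion the previous moment is a source of
  order \<open>d ^ (- q - 2)\<close>, which the contraction rate \<open>1 / d\<close> accumulates to
  order \<open>d ^ (- q - 1)\<close>. The constant \<open>K\<close> is uniform in the dimension, the
  start and the time.\<close>

lemma avg_pow_power_sum_decay:
  "\<exists>K\<ge>0. \<forall>d \<tau> x t. d \<ge> 2 \<longrightarrow> (1 - 1 / real d) ^ \<tau> \<le> 1 / real d ^ P \<longrightarrow> x \<in> unit_sphere d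
    \<longrightarrow> q \<le> P \<longrightarrow> t \<ge> q * \<tau> \<longrightarrow> (avg d ^^ t) (power_sum d (q + 1)) x \<le> K / real d ^ q"
proof (induction q)
  case 0
  have "(avg d ^^ t) (power_sum d (0 + 1)) x \<le> 1 / real d ^ 0"
    if "d \<ge> 2" "x \<in> unit_sphere d" for d x t
    using avg_pow_mono[of d "power_sum d 1" "\<lambda>_. 1" x t] that
    by (auto simp: avg_pow_const power_sum_le_one)
  then show ?case by (intro exI[of _ 1]) auto
next
  case (Suc q)
  then obtain K where K: "K \<ge> 0" and IH: "\<And>d \<tau> x t. d \<ge> 2 \<Longrightarrow> (1 - 1 / real d) ^ \<tau> \<le> 1 / real d ^ P
      \<Longrightarrow> x \<in> unit_sphere d \<Longrightarrow> q \<le> P \<Longrightarrow> t \<ge> q * \<tau>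
      \<Longrightarrow> (avg d ^^ t) (power_sum d (q + 1)) x \<le> K / real d ^ q"
    by blast
  \<comment> \<open>One factor 2 more than in \<open>avg_power_sum_le\<close>, to replace
    \<open>d * (d - 1)\<close> by the square of \<open>d\<close>.\<close>
  define B where "B = 2 ^ (q + 3) * K"
  have "(avg d ^^ t) (power_sum d (q + 2)) x \<le> (1 + B) / real d ^ (q + 1)"
    if d: "d \<ge> 2" and tau: "(1 - 1 / real d) ^ \<tau> \<le> 1 / real d ^ P" and x: "x \<in> unit_sphere d"
      and q: "q + 1 \<le> P" and t: "t \<ge> (q + 1) * \<tau>" for d \<tau> x t
  proof -
    define N where "N = real d * (real d - 1)"
    have N: "N > 0" using d by (simp add: N_def)
    define r where "r = 1 - 1 / real d"
    have r: "0 \<le> r" "r \<le> 1" using d by (auto simp: r_def field_simps)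
    \<comment> \<open>Time is counted from \<open>q * \<tau>\<close> on, when the bound on the
      previous moment is in force.\<close>
    define s where "s n = (avg d ^^ (q * \<tau> + n)) (power_sum d (q + 2)) x" for n
    have step: "s (Suc n) \<le> r * s n + B / real d ^ (q + 2)" for n
    proof -
      have "s (Suc n) = (avg d ^^ (q * \<tau> + n)) (avg d (power_sum d (q + 2))) x"
        by (simp add: s_def funpow_swap1)
      also have "\<dots> \<le> (avg d ^^ (q * \<tau> + n)) (\<lambda>x. r * power_sum d (q + 2) x
          + 2 ^ (q + 2) / N * power_sum d (q + 1) x) x"
        unfolding r_def N_def by (intro avg_pow_mono avg_power_sum_le d x)
      also have "\<dots> = r * s n
          + 2 ^ (q + 2) / N * (avg d ^^ (q * \<tau> + n)) (power_sum d (q + 1)) x"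
        by (simp only: avg_pow_add avg_pow_cmult s_def)
      also have "\<dots> \<le> r * s n + 2 ^ (q + 2) / N * (K / real d ^ q)"
        using N q by (intro add_left_mono mult_left_mono IH[OF d tau x]) auto
      also have "\<dots> \<le> r * s n + 2 ^ (q + 3) / (real d)\<^sup>2 * (K / real d ^ q)"
      proof (intro add_left_mono mult_right_mono)
        have "(real d)\<^sup>2 \<le> 2 * N" using d by (simp add: N_def power2_eq_square algebra_simps)
        then have "2 ^ (q + 2) * (real d)\<^sup>2 \<le> 2 ^ (q + 2) * (2 * N)" by (intro mult_left_mono) auto
        then show "2 ^ (q + 2) / N \<le> 2 ^ (q + 3) / (real d)\<^sup>2"
          using N d by (simp add: divide_simps eval_nat_numeral mult_ac)
      qed (use K in auto)
      also have "2 ^ (q + 3) / (real d)\<^sup>2 * (K / real d ^ q) = B / real d ^ (q + 2)"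
        by (simp add: B_def power_add power2_eq_square mult_ac)
      finally show ?thesis .
    qed
    \<comment> \<open>\<open>B / d ^ (q + 1)\<close> is the fixed point of the affine recursion in
      \<open>step\<close>, and the initial excess is at most 1.\<close>
    have bound: "s n \<le> r ^ n + B / real d ^ (q + 1)" for n
    proof (induction n)
      case 0
      have "s 0 \<le> 1"
        using avg_pow_mono[of d "power_sum d (q + 2)" "\<lambda>_. 1" x "q * \<tau>"] d x
        by (auto simp: avg_pow_const power_sum_le_one s_def)
      moreover have "B / real d ^ (q + 1) \<ge> 0" using K by (simp add: B_def)
      ultimately show ?case by simp
    next
      case (Suc n)
      have "s (Suc n) \<le> r * s n + B / real d ^ (q + 2)" by (rule step)
      also have "\<dots> \<le> r * (r ^ n + B / real d ^ (q + 1)) + B / real d ^ (q + 2)"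
        using Suc r by (intro add_right_mono mult_left_mono) auto
      also have "\<dots> = r ^ Suc n + B / real d ^ (q + 1)"
      proof -
        have eq: "B / real d ^ (q + 2) = B / real d ^ (q + 1) / real d" by simp
        have "r * (z + Y) + Y / real d = r * z + Y" for z Y by (simp add: r_def algebra_simps add_divide_distrib)
        then show ?thesis unfolding eq power_Suc .
      qed
      finally show ?case .
    qed
    have "(avg d ^^ t) (power_sum d (q + 2)) x = s (t - q * \<tau>)"
      using t by (simp add: s_def)
    also have "\<dots> \<le> r ^ (t - q * \<tau>) + B / real d ^ (q + 1)" by (rule bound)
    also have "r ^ (t - q * \<tau>) \<le> 1 / real d ^ (q + 1)"
    proof -
      have "r ^ (t - q * \<tau>) \<le> r ^ \<tau>"
        using r t by (intro power_decreasing) auto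
      also have "\<dots> \<le> 1 / real d ^ P" using tau by (simp add: r_def)
      also have "\<dots> \<le> 1 / real d ^ (q + 1)"
        using d q by (intro divide_left_mono power_increasing) auto
      finally show ?thesis .
    qed
    finally show ?thesis by (simp add: add_divide_distrib)
  qed
  then show ?case using K by (intro exI[of _ "1 + B"]) (auto simp: B_def eval_nat_numeral)
qed

subsection \<open>Exponential moments of the fourth power sum\<close>

text \<open>For \<open>z = - y < 0\<close> it suffices that \<open>1 - y + y ^ 2\<close> times the
  quadratic Taylor lower bound of \<open>exp y\<close> is at least 1.\<close>

lemma exp_le_quadratic:
  fixes z :: real
  assumes "z \<le> 1"
  shows "exp z \<le> 1 + z + z\<^sup>2"
proof (cases "z \<ge> 0")
  case True
  then show ?thesis using exp_bound[of z] assms by simp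
next
  case False
  define y where "y = - z"
  have y: "y > 0" using False by (simp add: y_def)
  have "1 \<le> (1 + y + y\<^sup>2 / 2) * (1 - y + y\<^sup>2)"
  proof -
    have "(1 + y + y\<^sup>2 / 2) * (1 - y + y\<^sup>2) = 1 + y ^ 2 / 2 + y ^ 3 / 2 + y ^ 4 / 2"
      by (simp add: eval_nat_numeral field_simps)
    then show ?thesis using y by simp
  qed
  also have "\<dots> \<le> exp y * (1 - y + y\<^sup>2)"
  proof (rule mult_right_mono)
    show "1 + y + y\<^sup>2 / 2 \<le> exp y" using y by (intro exp_lower_Taylor_quadratic) simp
    have "0 \<le> (1 - y / 2)\<^sup>2 + 3 / 4 * y\<^sup>2" by simp
    then show "0 \<le> 1 - y + y\<^sup>2" by (simp add: power2_eq_square field_simps)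
  qed
  finally show ?thesis by (simp add: y_def exp_minus field_simps)
qed

text \<open>An update changes the fourth power sum by \<open>D = 3ab - (a^2 + b^2)/2\<close>, where
  \<open>a\<close>, \<open>b\<close> are the squares of the two coordinates. Flatness makes
  \<open>\<theta> * D\<close> small enough for a quadratic expansion whose second-order term uses up
  a quarter of the negative drift, leaving 3/8 of each square. The result is again exponential in
  the power sum, with a smaller coefficient, so that it can be iterated.\<close>

lemma avg_exp_le:
  assumes d: "d \<ge> 2" and x: "x \<in> unit_sphere d" and flat: "\<And>i. i < d \<Longrightarrow> (x i)\<^sup>2 \<le> \<eta>"
    and \<theta>: "\<theta> \<ge> 0" "36 * \<theta> * \<eta>\<^sup>2 \<le> 1"
  shows "avg d (\<lambda>x. exp (\<theta> * power_sum d 2 x)) x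
    \<le> exp (\<theta> * (1 - 3 / (4 * real d)) * power_sum d 2 x + 3 * \<theta> / (real d * (real d - 1)))"
proof -
  define N where "N = real d * (real d - 1)"
  have N: "N > 0" using d by (simp add: N_def)
  define S where "S = power_sum d 2 x"
  define u where "u i = (x i)\<^sup>2" for i
  have u0: "u i \<ge> 0" for i by (simp add: u_def)
  have u1: "u i \<le> \<eta>" if "i < d" for i using flat that by (simp add: u_def)
  have "0 < d" using d by simp
  then have \<eta>: "\<eta> \<ge> 0" using u0[of 0] u1[of 0] by linarith
  have S1: "(\<Sum>i<d. u i) = 1" using x by (simp add: unit_sphere_def power_sum_def u_def)
  have S2: "(\<Sum>i<d. (u i)\<^sup>2) = S" by (simp add: S_def power_sum_def u_def)
  have "(\<Sum>p\<in>coord_pairs d. exp (\<theta> * power_sum d 2 (rot p x)))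
      \<le> (\<Sum>p\<in>coord_pairs d. exp (\<theta> * S)
          * (1 + \<theta> * (3 * (u (fst p) * u (snd p)) - 3 / 8 * (u (fst p))\<^sup>2 - 3 / 8 * (u (snd p))\<^sup>2)))"
  proof (rule sum_mono)
    fix p assume p: "p \<in> coord_pairs d"
    obtain i j where ij: "p = (i, j)" by force
    define a b where "a = u i" and "b = u j"
    have ab: "0 \<le> a" "0 \<le> b" "a \<le> \<eta>" "b \<le> \<eta>"
      using p u0 u1 by (auto simp: a_def b_def ij coord_pairs_def)
    define D where "D = 3 * (a * b) - (a\<^sup>2 + b\<^sup>2) / 2"
    have "((x i - x j)\<^sup>2 / 2)\<^sup>2 + ((x i + x j)\<^sup>2 / 2)\<^sup>2 = 3 * (a * b) + (a\<^sup>2 + b\<^sup>2) / 2"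
      by (simp add: a_def b_def u_def power2_eq_square field_simps)
    then have S': "power_sum d 2 (rot p x) = S + D"
      using power_sum_rot[of i j d 2 x] p
      by (simp add: ij S_def D_def a_def b_def u_def field_simps)
    have ab2: "a * b \<le> (a\<^sup>2 + b\<^sup>2) / 2"
      using zero_le_power2[of "a - b"] by (simp add: power2_eq_square algebra_simps)
    have sq: "a\<^sup>2 \<le> \<eta>\<^sup>2" "b\<^sup>2 \<le> \<eta>\<^sup>2" using ab by (auto intro!: power_mono)
    have "D \<le> 3 * \<eta>\<^sup>2" 
    proof -
      have "D \<le> 3 * (a * b)" by (simp add: D_def)
      also have "\<dots> \<le> 3 * \<eta>\<^sup>2"
        unfolding power2_eq_square using ab \<eta> by (intro mult_left_mono mult_mono) auto
      finally show ?thesis .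
    qed
    then have "\<theta> * D \<le> \<theta> * (3 * \<eta>\<^sup>2)" using \<theta> by (intro mult_left_mono)
    also have "\<dots> \<le> 1" using \<theta> \<eta> mult_nonneg_nonneg[of \<theta> "\<eta>\<^sup>2"] by simp
    finally have "exp (\<theta> * D) \<le> 1 + \<theta> * D + (\<theta> * D)\<^sup>2" by (rule exp_le_quadratic)
    \<comment> \<open>The constant 36 in the hypothesis is chosen so that the square fits into one
      eighth of the pure squares: \<open>9/4 * 2 * 8 = 36\<close>.\<close>
    also have "(\<theta> * D)\<^sup>2 \<le> \<theta> * ((a\<^sup>2 + b\<^sup>2) / 8)"
    proof -
      have "\<bar>D\<bar> \<le> 3 / 2 * (a\<^sup>2 + b\<^sup>2)"
        using ab2 mult_nonneg_nonneg[OF ab(1,2)] zero_le_power2[of a] zero_le_power2[of b]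
        unfolding D_def by linarith
      then have "D\<^sup>2 \<le> (3 / 2 * (a\<^sup>2 + b\<^sup>2))\<^sup>2" by (metis abs_ge_zero power2_abs power_mono)
      also have "\<dots> = 9 / 4 * ((a\<^sup>2 + b\<^sup>2) * (a\<^sup>2 + b\<^sup>2))"
        by (simp add: power2_eq_square algebra_simps)
      also have "\<dots> \<le> 9 / 4 * ((2 * \<eta>\<^sup>2) * (a\<^sup>2 + b\<^sup>2))"
        using sq by (intro mult_left_mono mult_right_mono) auto
      finally have "\<theta>\<^sup>2 * D\<^sup>2 \<le> \<theta>\<^sup>2 * (9 / 4 * ((2 * \<eta>\<^sup>2) * (a\<^sup>2 + b\<^sup>2)))"
        by (intro mult_left_mono) auto
      also have "\<dots> = (36 * \<theta> * \<eta>\<^sup>2) * (\<theta> * ((a\<^sup>2 + b\<^sup>2) / 8))"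
        by (simp add: power2_eq_square)
      also have "\<dots> \<le> 1 * (\<theta> * ((a\<^sup>2 + b\<^sup>2) / 8))"
        using \<theta> by (intro mult_right_mono) auto
      finally show ?thesis by (simp add: power_mult_distrib)
    qed
    finally have *: "exp (\<theta> * D) \<le> 1 + \<theta> * (3 * (a * b) - 3 / 8 * a\<^sup>2 - 3 / 8 * b\<^sup>2)"
      by (simp add: D_def algebra_simps)
    have "exp (\<theta> * power_sum d 2 (rot p x)) = exp (\<theta> * S) * exp (\<theta> * D)"
      by (simp add: S' distrib_left exp_add)
    also have "\<dots> \<le> exp (\<theta> * S) * (1 + \<theta> * (3 * (a * b) - 3 / 8 * a\<^sup>2 - 3 / 8 * b\<^sup>2))"
      by (intro mult_left_mono *) auto
    finally show "exp (\<theta> * power_sum d 2 (rot p x)) \<le> exp (\<theta> * S)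
          * (1 + \<theta> * (3 * (u (fst p) * u (snd p)) - 3 / 8 * (u (fst p))\<^sup>2 - 3 / 8 * (u (snd p))\<^sup>2))"
      by (simp add: ij a_def b_def)
  qed
  also have "\<dots> = exp (\<theta> * S)
      * (N + \<theta> * (3 * (\<Sum>p\<in>coord_pairs d. u (fst p) * u (snd p)) - 3 / 4 * ((real d - 1) * S)))"
  proof -
    have c: "real (card (coord_pairs d)) = N"
      using d by (simp add: card_coord_pairs N_def of_nat_diff)
    show ?thesis
      unfolding sum_distrib_left[symmetric] sum.distrib sum_subtractf sum_constant c
        sum_coord_pairs_fst[of "\<lambda>i. (u i)\<^sup>2"] sum_coord_pairs_snd[of "\<lambda>i. (u i)\<^sup>2"] S2
      by simp
  qed
  also have "\<dots> \<le> exp (\<theta> * S) * (N + \<theta> * (3 * 1 - 3 / 4 * ((real d - 1) * S)))"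
    using sum_coord_pairs_mult_le[of u u d] u0 S1 \<theta>
    by (intro mult_left_mono add_left_mono diff_right_mono) auto
  finally have "avg d (\<lambda>x. exp (\<theta> * power_sum d 2 x)) x
      \<le> exp (\<theta> * S) * (N + \<theta> * (3 * 1 - 3 / 4 * ((real d - 1) * S))) / N"
    unfolding avg_def N_def[symmetric] using N by (intro divide_right_mono) auto
  also have "\<dots> = exp (\<theta> * S) * (1 + (3 * \<theta> / N - \<theta> * (3 / (4 * real d)) * S))"
    using d by (simp add: N_def field_simps)
  also have "\<dots> \<le> exp (\<theta> * S) * exp (3 * \<theta> / N - \<theta> * (3 / (4 * real d)) * S)"
    by (intro mult_left_mono exp_ge_add_one_self) auto
  also have "\<dots> = exp (\<theta> * (1 - 3 / (4 * real d)) * S + 3 * \<theta> / N)"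
    by (simp add: exp_add[symmetric] algebra_simps)
  finally show ?thesis by (simp add: S_def N_def)
qed

text \<open>On vectors that are not \<open>\<eta>\<close>-flat the exponential bound may fail; there the trivial bound 1 is
  used, at the price of the probability that the walk ever visits such a vector.\<close>

lemma avg_pow_exp_bound:
  fixes f :: "(nat \<Rightarrow> real) \<Rightarrow> real"
  assumes d: "d \<ge> 2" and \<theta>: "\<theta> \<ge> 0" "36 * \<theta> * \<eta>\<^sup>2 \<le> 1" and B: "B \<ge> 0" "\<beta> \<ge> 0"
    and f1: "\<And>x. x \<in> unit_sphere d \<Longrightarrow> f x \<le> 1"
    and fB: "\<And>x. x \<in> unit_sphere d \<Longrightarrow> f x \<le> B * exp (\<theta> * power_sum d 2 x) + \<beta>"
    and x: "x \<in> unit_sphere d"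
  defines "r \<equiv> 1 - 3 / (4 * real d)" and "c \<equiv> 4 * \<theta> / (real d - 1)"
    and "bad \<equiv> \<lambda>x. of_bool (\<exists>i<d. (x i)\<^sup>2 > \<eta>)"
  shows "(avg d ^^ n) f x \<le> B * exp (\<theta> * r ^ n * power_sum d 2 x + c * (1 - r ^ n)) + \<beta>
    + (\<Sum>t<n. (avg d ^^ t) bad x)"
  using x
proof (induction n arbitrary: x)
  case 0
  then show ?case using fB by simp
next
  case (Suc n)
  have r: "0 \<le> r" "r \<le> 1" using d by (auto simp: r_def field_simps)
  have bad0: "(avg d ^^ t) bad x \<ge> 0" for t
    using avg_pow_mono[of d "\<lambda>_. 0" bad x t] Suc.prems d
    by (auto simp: avg_pow_const bad_def)
  have sum_Suc: "(\<Sum>t<Suc n. (avg d ^^ t) bad x) = bad x + (\<Sum>t<n. (avg d ^^ Suc t) bad x)"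
    by (subst sum.lessThan_Suc_shift) simp
  show ?case
  proof (cases "\<exists>i<d. (x i)\<^sup>2 > \<eta>")
    case True
    have "(avg d ^^ Suc n) f x \<le> 1"
      using avg_pow_mono[of d f "\<lambda>_. 1" x "Suc n"] f1 Suc.prems d
      by (simp only: avg_pow_const)
    also have "1 = bad x" using True by (simp add: bad_def)
    also have "\<dots> \<le> (\<Sum>t<Suc n. (avg d ^^ t) bad x)"
      unfolding sum_Suc using bad0 by (auto intro!: sum_nonneg simp del: funpow.simps)
    also have "\<dots> \<le> B * exp (\<theta> * r ^ Suc n * power_sum d 2 x + c * (1 - r ^ Suc n)) + \<beta>
        + (\<Sum>t<Suc n. (avg d ^^ t) bad x)"
      using B by simp
    finally show ?thesis .
  next
    case False
    \<comment> \<open>The first update is peeled off; the other \<open>n\<close> have already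
      lowered the coefficient to \<open>\<theta> * r ^ n\<close>. It never exceeds
      \<open>\<theta>\<close>, so the smallness condition of \<open>avg_exp_le\<close>
      persists.\<close>
    define \<theta>' where "\<theta>' = \<theta> * r ^ n"
    have \<theta>': "\<theta>' \<ge> 0" "36 * \<theta>' * \<eta>\<^sup>2 \<le> 1"
    proof -
      show "\<theta>' \<ge> 0" using \<theta> r by (simp add: \<theta>'_def)
      have "\<theta>' \<le> \<theta>" using \<theta> r by (simp add: \<theta>'_def mult_left_le power_le_one)
      then have "36 * \<theta>' * \<eta>\<^sup>2 \<le> 36 * \<theta> * \<eta>\<^sup>2" by (intro mult_right_mono) auto
      then show "36 * \<theta>' * \<eta>\<^sup>2 \<le> 1" using \<theta> by linarith
    qed
    have "(avg d ^^ Suc n) f x = avg d ((avg d ^^ n) f) x" by simp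
    also have "\<dots> \<le> avg d (\<lambda>x. B * exp (\<theta> * r ^ n * power_sum d 2 x + c * (1 - r ^ n)) + \<beta>
        + (\<Sum>t<n. (avg d ^^ t) bad x)) x"
      by (intro avg_mono d Suc)
    also have "(\<lambda>x. B * exp (\<theta> * r ^ n * power_sum d 2 x + c * (1 - r ^ n)) + \<beta>
        + (\<Sum>t<n. (avg d ^^ t) bad x))
      = (\<lambda>x. (B * exp (c * (1 - r ^ n))) * exp (\<theta>' * power_sum d 2 x) + \<beta>
        + (\<Sum>t<n. (avg d ^^ t) bad x))"
      by (simp add: \<theta>'_def exp_add mult_ac)
    also have "avg d \<dots> x = (B * exp (c * (1 - r ^ n))) * avg d (\<lambda>x. exp (\<theta>' * power_sum d 2 x)) x
        + \<beta> + (\<Sum>t<n. (avg d ^^ Suc t) bad x)"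
      by (simp add: avg_add avg_cmult avg_sum avg_const[OF d])
    also have "\<dots> \<le> (B * exp (c * (1 - r ^ n)))
          * exp (\<theta>' * r * power_sum d 2 x + 3 * \<theta>' / (real d * (real d - 1)))
        + \<beta> + (\<Sum>t<Suc n. (avg d ^^ t) bad x)"
    proof (intro add_mono mult_left_mono)
      show "avg d (\<lambda>x. exp (\<theta>' * power_sum d 2 x)) x
          \<le> exp (\<theta>' * r * power_sum d 2 x + 3 * \<theta>' / (real d * (real d - 1)))"
        unfolding r_def
        by (rule avg_exp_le[where \<eta> = \<eta>, OF d Suc.prems _ \<theta>']) (use False in force)
      show "(\<Sum>t<n. (avg d ^^ Suc t) bad x) \<le> (\<Sum>t<Suc n. (avg d ^^ t) bad x)"
        unfolding sum_Suc by (simp add: bad_def)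
    qed (use B in auto)
    also have "(B * exp (c * (1 - r ^ n)))
          * exp (\<theta>' * r * power_sum d 2 x + 3 * \<theta>' / (real d * (real d - 1)))
        = B * exp (\<theta> * r ^ Suc n * power_sum d 2 x + c * (1 - r ^ Suc n))"
    proof -
      \<comment> \<open>The choice of \<open>c\<close> makes the constants gained at successive
        steps telescope to \<open>c * (1 - r ^ Suc n)\<close>.\<close>
      have "3 * \<theta>' / (real d * (real d - 1)) = c * (1 - r) * r ^ n"
        using d by (simp add: \<theta>'_def c_def r_def field_simps)
      then show ?thesis by (simp add: mult.assoc exp_add[symmetric] \<theta>'_def algebra_simps)
    qed
    finally show ?thesis .
  qed
qed

section \<open>Visits to non-flat vectors and the burn-in phase\<close>

text \<open>Markov's inequality: one squared coordinate above \<open>\<eta>\<close> already forces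
  the power sum to be at least \<open>\<eta> ^ p\<close>.\<close>

lemma avg_pow_bad_le:
  assumes d: "d \<ge> 2" and x: "x \<in> unit_sphere d" and \<eta>: "\<eta> > 0"
  shows "(avg d ^^ t) (\<lambda>x. of_bool (\<exists>i<d. (x i)\<^sup>2 > \<eta>)) x \<le> (avg d ^^ t) (power_sum d p) x / \<eta> ^ p"
proof -
  have "of_bool (\<exists>i<d. (x i)\<^sup>2 > \<eta>) \<le> 1 / \<eta> ^ p * power_sum d p x" for x
  proof (cases "\<exists>i<d. (x i)\<^sup>2 > \<eta>")
    case True
    then obtain i where i: "i < d" "(x i)\<^sup>2 > \<eta>" by blast
    then have "\<eta> ^ p \<le> ((x i)\<^sup>2) ^ p" using \<eta> by (intro power_mono) auto
    also have "\<dots> \<le> power_sum d p x"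
      unfolding power_sum_def using i by (intro member_le_sum) auto
    finally show ?thesis using True \<eta> by (simp add: field_simps)
  qed (use \<eta> in \<open>auto simp: power_sum_nonneg\<close>)
  then have "(avg d ^^ t) (\<lambda>x. of_bool (\<exists>i<d. (x i)\<^sup>2 > \<eta>)) x
      \<le> (avg d ^^ t) (\<lambda>x. 1 / \<eta> ^ p * power_sum d p x) x"
    by (intro avg_pow_mono d x)
  then show ?thesis by (simp only: avg_pow_cmult) simp
qed

text \<open>The first \<open>T - n\<close> steps flatten the vector, so each of the last
  \<open>n\<close> times costs at most \<open>\<epsilon>\<close>. These \<open>n\<close> steps
  shrink the coefficient of the power sum below 1, and the power sum is itself at most 1, so the
  bound no longer depends on the start.\<close>

lemma avg_pow_burn_in_bound:
  fixes f :: "(nat \<Rightarrow> real) \<Rightarrow> real"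
  assumes d: "d \<ge> 2" and \<theta>: "\<theta> \<ge> 0" "36 * \<theta> * \<eta>\<^sup>2 \<le> 1" and B: "B \<ge> 0" "\<beta> \<ge> 0"
    and f1: "\<And>x. x \<in> unit_sphere d \<Longrightarrow> f x \<le> 1"
    and fB: "\<And>x. x \<in> unit_sphere d \<Longrightarrow> f x \<le> B * exp (\<theta> * power_sum d 2 x) + \<beta>"
    and x: "x \<in> unit_sphere d"
    and n: "\<theta> * (1 - 3 / (4 * real d)) ^ n \<le> 1"
    and bad: "\<And>t. t \<ge> t0 \<Longrightarrow> (avg d ^^ t) (\<lambda>x. of_bool (\<exists>i<d. (x i)\<^sup>2 > \<eta>)) x \<le> \<epsilon>"
    and T: "T \<ge> t0 + n"
  shows "(avg d ^^ T) f x \<le> B * exp (1 + 4 * \<theta> / (real d - 1)) + \<beta> + real n * \<epsilon>"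
proof -
  define r where "r = 1 - 3 / (4 * real d)"
  define c where "c = 4 * \<theta> / (real d - 1)"
  define bad where "bad = (\<lambda>x. of_bool (\<exists>i<d. (x i)\<^sup>2 > \<eta>) :: real)"
  have r: "0 \<le> r" "r \<le> 1" using d by (auto simp: r_def field_simps)
  have c: "c \<ge> 0" using \<theta> d by (simp add: c_def)
  have "(avg d ^^ T) f x = (avg d ^^ (T - n)) ((avg d ^^ n) f) x"
    using T funpow_add[of "T - n" n "avg d"] by simp
  also have "\<dots> \<le> (avg d ^^ (T - n)) (\<lambda>x. B * exp (1 + c) + \<beta> + (\<Sum>t<n. (avg d ^^ t) bad x)) x"
  proof (intro avg_pow_mono d x)
    fix x assume x: "x \<in> unit_sphere d"
    have "(avg d ^^ n) f x \<le> B * exp (\<theta> * r ^ n * power_sum d 2 x + c * (1 - r ^ n)) + \<beta>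
        + (\<Sum>t<n. (avg d ^^ t) bad x)"
      using avg_pow_exp_bound[OF d \<theta> B f1 fB x, of n] unfolding r_def c_def bad_def by simp
    moreover have "exp (\<theta> * r ^ n * power_sum d 2 x + c * (1 - r ^ n)) \<le> exp (1 + c)"
    proof -
      have "\<theta> * r ^ n * power_sum d 2 x \<le> 1 * 1"
        using n power_sum_le_one[OF x, of 2] power_sum_nonneg \<theta> r
        by (intro mult_mono) (auto simp: r_def)
      moreover have "c * (1 - r ^ n) \<le> c * 1" using c r by (intro mult_left_mono) auto
      ultimately show ?thesis by simp
    qed
    ultimately show "(avg d ^^ n) f x \<le> B * exp (1 + c) + \<beta> + (\<Sum>t<n. (avg d ^^ t) bad x)"
      using B mult_left_mono[of "exp (\<theta> * r ^ n * power_sum d 2 x + c * (1 - r ^ n))" "exp (1 + c)" B]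
      by linarith
  qed
  also have "\<dots> = B * exp (1 + c) + \<beta> + (\<Sum>t<n. (avg d ^^ (T - n + t)) bad x)"
    by (simp add: avg_pow_add avg_pow_sum avg_pow_const[OF d] funpow_add)
  also have "(\<Sum>t<n. (avg d ^^ (T - n + t)) bad x) \<le> (\<Sum>t<n. \<epsilon>)"
    unfolding bad_def using T by (intro sum_mono bad) simp
  finally show ?thesis by (simp add: c_def)
qed

subsection \<open>Duality and random signs\<close>

definition dot :: "nat \<Rightarrow> (nat \<Rightarrow> real) \<Rightarrow> (nat \<Rightarrow> real) \<Rightarrow> real" where
  "dot d v x = (\<Sum>i<d. v i * x i)"

definition basis_vec :: "nat \<Rightarrow> nat \<Rightarrow> real" where
  "basis_vec l = (\<lambda>i. of_bool (i = l))"

definition flip_signs :: "nat set \<Rightarrow> (nat \<Rightarrow> real) \<Rightarrow> nat \<Rightarrow> real" where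
  "flip_signs S x = (\<lambda>i. if i \<in> S then - x i else x i)"

lemma basis_vec_unit_sphere:
  assumes "l < d"
  shows "basis_vec l \<in> unit_sphere d"
proof -
  have "((basis_vec l i)\<^sup>2) ^ 1 = (if i = l then 1 else 0)" for i
    by (simp add: basis_vec_def)
  then show ?thesis using assms by (simp add: unit_sphere_def power_sum_def)
qed

lemma dot_basis_vec:
  assumes "k < d"
  shows "dot d (basis_vec k) x = x k"
proof -
  have "basis_vec k i * x i = (if i = k then x i else 0)" for i
    by (simp add: basis_vec_def)
  then show ?thesis using assms by (simp add: dot_def)
qed

text \<open>The transpose of a rotation is the rotation of the reversed pair.\<close>

lemma dot_rot:
  assumes "(i, j) \<in> coord_pairs d"
  shows "dot d v (rot (i, j) x) = dot d (rot (j, i) v) x"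
proof -
  have "i \<noteq> j" using assms by (auto simp: coord_pairs_def)
  have "(\<Sum>k\<in>{..<d} - {i} - {j}. v k * rot (i, j) x k) = (\<Sum>k\<in>{..<d} - {i} - {j}. rot (j, i) v k * x k)"
    by (intro sum.cong) (auto simp: rot_def)
  then show ?thesis
    using \<open>i \<noteq> j\<close> unfolding dot_def sum_two[OF assms] by (simp add: rot_def field_simps)
qed

text \<open>Reversal permutes the ordered pairs, so an averaged update may act on either side of the
  inner product.\<close>

lemma avg_dot: "avg d (\<lambda>x. F (dot d v x)) x = avg d (\<lambda>w. F (dot d w x)) v"
proof -
  have "(\<Sum>p\<in>coord_pairs d. F (dot d v (rot p x))) = (\<Sum>p\<in>coord_pairs d. F (dot d (rot (snd p, fst p) v) x))"
    by (intro sum.cong) (auto simp: dot_rot)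
  also have "\<dots> = (\<Sum>p\<in>coord_pairs d. F (dot d (rot p v) x))"
    by (rule sum_coord_pairs_swap)
  finally show ?thesis by (simp add: avg_def)
qed

text \<open>The two operators act on different variables, and the iterate is linear over the finite
  sum defining the other.\<close>

lemma avg_avg_pow_commute:
  "avg d (\<lambda>x. (avg d ^^ n) (\<lambda>w. h w x) v) x = (avg d ^^ n) (\<lambda>w. avg d (h w) x) v"
proof -
  define N where "N = 1 / (real d * (real d - 1))"
  have avg_eq: "avg d f y = N * (\<Sum>p\<in>coord_pairs d. f (rot p y))" for f y
    by (simp add: avg_def N_def)
  have "(\<lambda>w. avg d (h w) x) = (\<lambda>w. N * (\<Sum>p\<in>coord_pairs d. h w (rot p x)))"
    by (simp add: avg_eq)
  then have "(avg d ^^ n) (\<lambda>w. avg d (h w) x) v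
      = N * (\<Sum>p\<in>coord_pairs d. (avg d ^^ n) (\<lambda>w. h w (rot p x)) v)"
    by (simp add: avg_pow_cmult avg_pow_sum)
  then show ?thesis by (subst avg_eq) simp
qed

text \<open>This moves the second half of the walk onto the other vector, so that an entry becomes
  the inner product of two independent walks.\<close>

lemma avg_pow_dot: "(avg d ^^ n) (\<lambda>x. F (dot d v x)) x = (avg d ^^ n) (\<lambda>w. F (dot d w x)) v"
proof (induction n arbitrary: x)
  case (Suc n)
  have "(avg d ^^ Suc n) (\<lambda>x. F (dot d v x)) x = avg d (\<lambda>x. (avg d ^^ n) (\<lambda>w. F (dot d w x)) v) x"
    using ext[of "(avg d ^^ n) (\<lambda>x. F (dot d v x))", OF Suc] by simp
  also have "\<dots> = (avg d ^^ n) (\<lambda>w. avg d (\<lambda>x. F (dot d w x)) x) v"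
    by (rule avg_avg_pow_commute)
  also have "(\<lambda>w. avg d (\<lambda>x. F (dot d w x)) x) = avg d (\<lambda>w. F (dot d w x))"
    by (rule ext) (rule avg_dot)
  finally show ?case by (simp add: funpow_swap1)
qed simp

text \<open>Conjugating a rotation by a diagonal sign matrix yields the rotation itself or its inverse,
  the latter being the rotation of the reversed pair.\<close>

lemma avg_flip_signs: "avg d (\<lambda>x. f (flip_signs S x)) x = avg d f (flip_signs S x)"
proof -
  define \<sigma> where "\<sigma> p = (if fst p \<in> S \<longleftrightarrow> snd p \<in> S then p else (snd p, fst p))" for p :: "nat \<times> nat"
  have "(\<Sum>p\<in>coord_pairs d. f (flip_signs S (rot p x)))
      = (\<Sum>p\<in>coord_pairs d. f (rot p (flip_signs S x)))"
  proof (rule sum.reindex_bij_witness[of _ \<sigma> \<sigma>])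
    fix p assume p: "p \<in> coord_pairs d"
    then show "\<sigma> (\<sigma> p) = p" "\<sigma> (\<sigma> p) = p" "\<sigma> p \<in> coord_pairs d" "\<sigma> p \<in> coord_pairs d"
      by (auto simp: \<sigma>_def coord_pairs_def)
    obtain i j where ij: "p = (i, j)" by force
    then have "i \<noteq> j" using p by (auto simp: coord_pairs_def)
    then have "rot (\<sigma> p) (flip_signs S x) k = flip_signs S (rot p x) k" for k
      unfolding ij by (cases "i \<in> S"; cases "j \<in> S")
        (simp_all add: \<sigma>_def rot_def flip_signs_def add_divide_distrib diff_divide_distrib)
    then have "rot (\<sigma> p) (flip_signs S x) = flip_signs S (rot p x)" by (rule ext)
    then show "f (rot (\<sigma> p) (flip_signs S x)) = f (flip_signs S (rot p x))" by simp
  qed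
  then show ?thesis by (simp add: avg_def)
qed

lemma avg_pow_flip_signs:
  "(avg d ^^ n) (\<lambda>x. f (flip_signs S x)) x = (avg d ^^ n) f (flip_signs S x)"
proof (induction n arbitrary: x)
  case (Suc n)
  show ?case
    using ext[of "(avg d ^^ n) (\<lambda>x. f (flip_signs S x))", OF Suc]
    by (simp add: avg_flip_signs[of _ "(avg d ^^ n) f"])
qed simp

text \<open>On a basis vector a sign flip is either the identity or the global negation, and
  \<open>f\<close> is even.\<close>

lemma avg_pow_basis_vec_flip_signs:
  assumes "\<And>x. f (flip_signs UNIV x) = f x"
  shows "(avg d ^^ n) (\<lambda>x. f (flip_signs S x)) (basis_vec l) = (avg d ^^ n) f (basis_vec l)"
proof (cases "l \<in> S")
  case True
  then have "flip_signs S (basis_vec l) = flip_signs UNIV (basis_vec l)"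
    by (auto simp: flip_signs_def basis_vec_def)
  then show ?thesis
    using avg_pow_flip_signs[of n d f UNIV "basis_vec l"] by (simp add: assms avg_pow_flip_signs)
next
  case False
  then have "flip_signs S (basis_vec l) = basis_vec l"
    by (auto simp: flip_signs_def basis_vec_def)
  then show ?thesis by (simp add: avg_pow_flip_signs)
qed

section \<open>A Chernoff bound for random signs\<close>

text \<open>Hoeffding's lemma for a fair sign: its auxiliary inequality with weight 1/2 and
  parameter \<open>2 * t\<close>, extended to negative \<open>t\<close> by evenness.\<close>

lemma cosh_le_exp_half_square: "cosh (t::real) \<le> exp (t\<^sup>2 / 2)"
proof -
  have pos: "cosh t \<le> exp (t\<^sup>2 / 2)" if "t \<ge> 0" for t :: real
  proof -
    have e: "1 + 1 / 2 * (exp (2 * t) - 1) = exp t * cosh t"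
      by (simp add: cosh_def algebra_simps flip: exp_add)
    have "- (2 * t) * (1 / 2) + ln (1 + 1 / 2 * (exp (2 * t) - 1)) \<le> (2 * t)\<^sup>2 / 8"
      by (rule Hoeffdings_lemma_aux) (use that in auto)
    then have "ln (cosh t) \<le> t\<^sup>2 / 2"
      unfolding e by (simp add: ln_mult power2_eq_square)
    then show ?thesis by (metis cosh_real_pos exp_le_cancel_iff exp_ln)
  qed
  show ?thesis using pos[of t] pos[of "- t"] by (cases "t \<ge> 0") auto
qed

text \<open>Expanding a product of sums over subsets: the moment generating function of independent
  signs factorises.\<close>

lemma sum_exp_flip_signs:
  "(\<Sum>S\<in>Pow {..<d}. exp (c * dot d v (flip_signs S x))) = 2 ^ d * (\<Prod>i<d. cosh (c * (v i * x i)))"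
proof -
  have "exp (c * dot d v (flip_signs S x))
      = (\<Prod>i\<in>S. exp (- (c * (v i * x i)))) * (\<Prod>i\<in>{..<d} - S. exp (c * (v i * x i)))"
    if "S \<in> Pow {..<d}" for S
  proof -
    have S: "S \<subseteq> {..<d}" "finite S" using that finite_subset by auto
    have "c * dot d v (flip_signs S x) = (\<Sum>i<d. c * (v i * flip_signs S x i))"
      by (simp add: dot_def sum_distrib_left)
    also have "\<dots> = (\<Sum>i\<in>{..<d} - S. c * (v i * flip_signs S x i)) + (\<Sum>i\<in>S. c * (v i * flip_signs S x i))"
      using S by (intro sum.subset_diff) auto
    also have "\<dots> = (\<Sum>i\<in>{..<d} - S. c * (v i * x i)) + (\<Sum>i\<in>S. - (c * (v i * x i)))"
      by (intro arg_cong2[where f = "(+)"] sum.cong) (auto simp: flip_signs_def)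
    finally show ?thesis using S by (simp add: exp_add exp_sum mult_ac)
  qed
  then have "(\<Sum>S\<in>Pow {..<d}. exp (c * dot d v (flip_signs S x)))
      = (\<Prod>i<d. exp (- (c * (v i * x i))) + exp (c * (v i * x i)))"
    by (simp add: prod_add)
  also have "\<dots> = (\<Prod>i<d. 2 * cosh (c * (v i * x i)))"
    by (intro prod.cong) (auto simp: cosh_def)
  finally show ?thesis by (simp add: prod.distrib)
qed

text \<open>The left side is the probability of \<open>\<bar>dot d v x\<bar> > b\<close> after
  independent fair signs are attached to the coordinates of \<open>x\<close>. The fourth powers of
  \<open>v\<close> and \<open>x\<close> end up in separate factors, so the two walks can be averaged
  one after the other.\<close>

lemma random_signs_tail:
  assumes c: "c \<ge> 0"
  shows "(\<Sum>S\<in>Pow {..<d}. of_bool (\<bar>dot d v (flip_signs S x)\<bar> > b)) / 2 ^ d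
    \<le> 2 * exp (- c * b) * exp (c\<^sup>2 / 4 * power_sum d 2 v) * exp (c\<^sup>2 / 4 * power_sum d 2 x)"
proof -
  let ?P = "\<Prod>i<d. cosh (c * (v i * x i))"
  have "of_bool (\<bar>z\<bar> > b) \<le> exp (- c * b) * (exp (c * z) + exp (- c * z))" for z
  proof (cases "\<bar>z\<bar> > b")
    case True
    have "1 \<le> exp (- c * b) * exp (c * \<bar>z\<bar>)"
      using True c mult_left_mono[of b "\<bar>z\<bar>" c] by (simp flip: exp_add)
    also have "\<dots> \<le> exp (- c * b) * (exp (c * z) + exp (- c * z))"
      by (intro mult_left_mono) (auto simp: abs_if)
    finally show ?thesis using True by simp
  qed (auto intro!: mult_nonneg_nonneg add_nonneg_nonneg)
  then have "(\<Sum>S\<in>Pow {..<d}. of_bool (\<bar>dot d v (flip_signs S x)\<bar> > b))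
      \<le> (\<Sum>S\<in>Pow {..<d}. exp (- c * b) * (exp (c * dot d v (flip_signs S x))
          + exp (- c * dot d v (flip_signs S x))))"
    by (intro sum_mono)
  also have "\<dots> = exp (- c * b) * (2 ^ d * ?P + 2 ^ d * ?P)"
    unfolding sum_distrib_left[symmetric] sum.distrib sum_exp_flip_signs by simp
  finally have "(\<Sum>S\<in>Pow {..<d}. of_bool (\<bar>dot d v (flip_signs S x)\<bar> > b)) / 2 ^ d
      \<le> exp (- c * b) * (2 ^ d * ?P + 2 ^ d * ?P) / 2 ^ d"
    by (rule divide_right_mono) simp
  also have "\<dots> = 2 * exp (- c * b) * ?P" by (simp add: field_simps)
  also have "\<dots> \<le> 2 * exp (- c * b)
      * (exp (c\<^sup>2 / 4 * power_sum d 2 v) * exp (c\<^sup>2 / 4 * power_sum d 2 x))"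
  proof (rule mult_left_mono)
    have "?P \<le> (\<Prod>i<d. exp (c\<^sup>2 / 4 * ((v i)\<^sup>2)\<^sup>2 + c\<^sup>2 / 4 * ((x i)\<^sup>2)\<^sup>2))"
    proof (intro prod_mono conjI)
      fix i
      \<comment> \<open>AM-GM, the step that decouples \<open>v\<close> from
        \<open>x\<close>.\<close>
      have "2 * ((v i)\<^sup>2 * (x i)\<^sup>2) \<le> ((v i)\<^sup>2)\<^sup>2 + ((x i)\<^sup>2)\<^sup>2"
        using zero_le_power2[of "(v i)\<^sup>2 - (x i)\<^sup>2"] unfolding power2_diff by linarith
      then have "c\<^sup>2 / 4 * (2 * ((v i)\<^sup>2 * (x i)\<^sup>2)) \<le> c\<^sup>2 / 4 * (((v i)\<^sup>2)\<^sup>2 + ((x i)\<^sup>2)\<^sup>2)"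
        by (intro mult_left_mono) auto
      moreover have "cosh (c * (v i * x i)) \<le> exp ((c * (v i * x i))\<^sup>2 / 2)"
        by (rule cosh_le_exp_half_square)
      moreover have "(c * (v i * x i))\<^sup>2 / 2 = c\<^sup>2 / 4 * (2 * ((v i)\<^sup>2 * (x i)\<^sup>2))"
        by (simp add: power_mult_distrib)
      ultimately show "cosh (c * (v i * x i)) \<le> exp (c\<^sup>2 / 4 * ((v i)\<^sup>2)\<^sup>2 + c\<^sup>2 / 4 * ((x i)\<^sup>2)\<^sup>2)"
        by (smt (verit, best) distrib_left exp_le_cancel_iff)
    qed (simp add: less_imp_le[OF cosh_real_pos])
    also have "\<dots> = exp (c\<^sup>2 / 4 * power_sum d 2 v + c\<^sup>2 / 4 * power_sum d 2 x)"
      by (simp add: power_sum_def sum_distrib_left sum.distrib flip: exp_sum)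
    finally show "?P \<le> exp (c\<^sup>2 / 4 * power_sum d 2 v) * exp (c\<^sup>2 / 4 * power_sum d 2 x)"
      by (simp add: exp_add)
  qed simp
  finally show ?thesis by (simp add: mult.assoc)
qed

lemma entry_tail:
  assumes d: "d \<ge> 2" and kl: "k < d" "l < d" and c: "c \<ge> 0" "9 * c\<^sup>2 * \<eta>\<^sup>2 \<le> 1"
    and n: "c\<^sup>2 / 4 * (1 - 3 / (4 * real d)) ^ n \<le> 1"
    and bad: "\<And>t x. t \<ge> t0 \<Longrightarrow> x \<in> unit_sphere d \<Longrightarrow>
      (avg d ^^ t) (\<lambda>x. of_bool (\<exists>i<d. (x i)\<^sup>2 > \<eta>)) x \<le> \<epsilon>"
    and \<epsilon>: "\<epsilon> \<ge> 0" and T: "T \<ge> 2 * (t0 + n)"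
  shows "(avg d ^^ T) (\<lambda>x. of_bool (\<bar>x k\<bar> > b)) (basis_vec l)
    \<le> 2 * exp (- c * b) * (exp (1 + c\<^sup>2 / (real d - 1)))\<^sup>2 + 2 * real n * \<epsilon>"
proof -
  define F :: "real \<Rightarrow> real" where "F z = of_bool (\<bar>z\<bar> > b)" for z
  define T1 where "T1 = t0 + n"
  define T2 where "T2 = T - T1"
  have TT: "T = T1 + T2" "T1 \<ge> t0 + n" "T2 \<ge> t0 + n" using T by (auto simp: T1_def T2_def)
  define G where "G w x = (\<Sum>S\<in>Pow {..<d}. F (dot d w (flip_signs S x))) / 2 ^ d" for w x
  \<comment> \<open>With \<open>\<theta> = c^2 / 4\<close> the hypothesis on \<open>9 * c^2\<close>
    becomes the flatness condition with constant 36.\<close>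
  define \<theta> where "\<theta> = c\<^sup>2 / 4"
  have \<theta>: "\<theta> \<ge> 0" "36 * \<theta> * \<eta>\<^sup>2 \<le> 1" "\<theta> * (1 - 3 / (4 * real d)) ^ n \<le> 1"
    using c n by (auto simp: \<theta>_def)
  define E where "E = exp (1 + 4 * \<theta> / (real d - 1))"
  have G1: "G w x \<le> 1" for w x
  proof -
    have "(\<Sum>S\<in>Pow {..<d}. F (dot d w (flip_signs S x))) \<le> (\<Sum>S\<in>Pow {..<d}. 1)"
      by (intro sum_mono) (simp add: F_def)
    then show ?thesis by (simp add: G_def card_Pow)
  qed
  have GB: "G w x \<le> 2 * exp (- c * b) * exp (\<theta> * power_sum d 2 x) * exp (\<theta> * power_sum d 2 w)" for w x
    using random_signs_tail[OF c(1), where d = d and v = w and x = x and b = b] by (simp add: G_def F_def \<theta>_def mult_ac)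
  define f where "f x = (avg d ^^ T2) (\<lambda>w. F (dot d w x)) (basis_vec k)" for x
  define g where "g x = (avg d ^^ T2) (\<lambda>w. G w x) (basis_vec k)" for x
  have even: "f (flip_signs UNIV x) = f x" for x
  proof -
    have "dot d w (flip_signs UNIV x) = - dot d w x" for w
      by (simp add: dot_def flip_signs_def sum_negf)
    then show ?thesis by (simp add: f_def F_def)
  qed
  have "(avg d ^^ T) (\<lambda>x. of_bool (\<bar>x k\<bar> > b)) (basis_vec l)
      = (avg d ^^ T1) ((avg d ^^ T2) (\<lambda>x. F (dot d (basis_vec k) x))) (basis_vec l)"
    using kl by (simp add: TT(1) funpow_add F_def dot_basis_vec)
  also have "(avg d ^^ T2) (\<lambda>x. F (dot d (basis_vec k) x)) = f"
    unfolding f_def fun_eq_iff using avg_pow_dot by blast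
  \<comment> \<open>Random signs enter here: \<open>f\<close> is even, so every flip pattern gives
    the same value at the basis vector, and the average over all patterns changes nothing.\<close>
  also have "(avg d ^^ T1) f (basis_vec l)
      = 1 / 2 ^ d * (\<Sum>S\<in>Pow {..<d}. (avg d ^^ T1) (\<lambda>x. f (flip_signs S x)) (basis_vec l))"
    by (simp add: avg_pow_basis_vec_flip_signs even card_Pow)
  also have "\<dots> = (avg d ^^ T1) (\<lambda>x. 1 / 2 ^ d * (\<Sum>S\<in>Pow {..<d}. f (flip_signs S x))) (basis_vec l)"
    by (simp only: avg_pow_cmult avg_pow_sum)
  also have "(\<lambda>x. 1 / 2 ^ d * (\<Sum>S\<in>Pow {..<d}. f (flip_signs S x))) = g"
  proof
    fix x
    have "(\<lambda>w. G w x) = (\<lambda>w. 1 / 2 ^ d * (\<Sum>S\<in>Pow {..<d}. F (dot d w (flip_signs S x))))"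
      by (simp add: G_def)
    then show "1 / 2 ^ d * (\<Sum>S\<in>Pow {..<d}. f (flip_signs S x)) = g x"
      unfolding f_def g_def by (simp only: avg_pow_cmult avg_pow_sum)
  qed
  also have "(avg d ^^ T1) g (basis_vec l)
      \<le> 2 * exp (- c * b) * E * exp (1 + 4 * \<theta> / (real d - 1)) + real n * \<epsilon> + real n * \<epsilon>"
  \<comment> \<open>Burn-in is used twice. For fixed \<open>x\<close> it bounds the average over
    \<open>w\<close>, with the exponential in \<open>x\<close> as part of the prefactor
    \<open>B\<close>; the resulting error \<open>n * \<epsilon>\<close> then serves as
    \<open>\<beta>\<close> for the average over \<open>x\<close>.\<close>
  proof (rule avg_pow_burn_in_bound[OF d \<theta>(1,2) _ _ _ _ basis_vec_unit_sphere \<theta>(3) bad TT(2)])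
    fix x assume x: "x \<in> unit_sphere d"
    show "g x \<le> 1"
      using avg_pow_mono[of d "\<lambda>w. G w x" "\<lambda>_. 1" "basis_vec k" T2] d G1 kl
      by (simp add: g_def avg_pow_const basis_vec_unit_sphere)
    have "g x \<le> 2 * exp (- c * b) * exp (\<theta> * power_sum d 2 x) * exp (1 + 4 * \<theta> / (real d - 1)) + 0
        + real n * \<epsilon>"
      unfolding g_def
      by (rule avg_pow_burn_in_bound[OF d \<theta>(1,2) _ _ _ _ basis_vec_unit_sphere \<theta>(3) bad TT(3)])
        (use G1 GB kl in \<open>auto intro: basis_vec_unit_sphere\<close>)
    then show "g x \<le> 2 * exp (- c * b) * E * exp (\<theta> * power_sum d 2 x) + real n * \<epsilon>"
      by (simp add: E_def mult_ac)
  qed (use \<epsilon> kl in \<open>auto simp: E_def intro: basis_vec_unit_sphere\<close>)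
  finally show ?thesis by (simp add: E_def \<theta>_def power2_eq_square mult_ac)
qed

subsection \<open>From the matrix walk to the averaging operator\<close>

text \<open>Column \<open>l\<close> of the product is the image of basis vector \<open>l\<close>
  under the same updates; in both folds the head of the list acts first.\<close>

lemma ora_product_entry:
  assumes "set ps \<subseteq> coord_pairs d" "k < d" "l < d"
  shows "ora_product d ps $$ (k, l) = fold rot ps (basis_vec l) k"
    and "ora_product d ps \<in> carrier_mat d d"
proof -
  have step: "(ora_rotation d i j * Q) $$ (k, l) = rot (i, j) x k"
    if ij: "(i, j) \<in> coord_pairs d" and Q: "Q \<in> carrier_mat d d" and x: "\<And>k. k < d \<Longrightarrow> Q $$ (k, l) = x k"
      and k: "k < d" for Q x i j k
  proof -
    have "i < d" "j < d" "i \<noteq> j" using ij by (auto simp: coord_pairs_def)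
    have "(ora_rotation d i j * Q) $$ (k, l) = (\<Sum>m<d. ora_rotation d i j $$ (k, m) * x m)"
      using Q k assms(3) x by (simp add: scalar_prod_def ora_rotation_def lessThan_atLeast0)
    also have "\<dots> = ora_rotation d i j $$ (k, i) * x i + (ora_rotation d i j $$ (k, j) * x j
        + (\<Sum>m\<in>{..<d} - {i} - {j}. if m = k then x m else 0))"
      unfolding sum_two[OF ij]
      by (intro arg_cong2[where f = "(+)"] refl sum.cong)
        (use k in \<open>auto simp: ora_rotation_def\<close>)
    also have "\<dots> = rot (i, j) x k"
      using k \<open>i < d\<close> \<open>j < d\<close> \<open>i \<noteq> j\<close>
      by (auto simp: ora_rotation_def rot_def sum.delta field_simps)
    finally show ?thesis .
  qed
  have "fold (\<lambda>(i, j) Q. ora_rotation d i j * Q) ps Q \<in> carrier_mat d d \<and>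
      (\<forall>k<d. fold (\<lambda>(i, j) Q. ora_rotation d i j * Q) ps Q $$ (k, l) = fold rot ps x k)"
    if "Q \<in> carrier_mat d d" "\<And>k. k < d \<Longrightarrow> Q $$ (k, l) = x k" for Q x
    using assms(1) that
  proof (induction ps arbitrary: Q x)
    case (Cons p ps)
    obtain i j where p: "p = (i, j)" by force
    have "ora_rotation d i j * Q \<in> carrier_mat d d"
      using Cons.prems(2) by (intro mult_carrier_mat[of _ d d]) (simp_all add: ora_rotation_def)
    then show ?case
      using Cons.IH[of "ora_rotation d i j * Q" "rot (i, j) x"] Cons.prems step[of i j Q x] by (simp add: p)
  qed simp
  from this[of "1\<^sub>m d" "basis_vec l"] show "ora_product d ps $$ (k, l) = fold rot ps (basis_vec l) k"
    and "ora_product d ps \<in> carrier_mat d d"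
    using assms by (auto simp: ora_product_def basis_vec_def)
qed

text \<open>Induction on the first update: the head of the list is drawn first and corresponds to
  the outermost \<open>avg\<close>.\<close>

lemma expectation_walk:
  fixes f :: "(nat \<Rightarrow> real) \<Rightarrow> real"
  assumes d: "d \<ge> 2"
  shows "measure_pmf.expectation (replicate_pmf T (pmf_of_set (coord_pairs d)))
      (\<lambda>ps. f (fold rot ps x)) = (avg d ^^ T) f x"
proof (induction T arbitrary: x)
  case (Suc T)
  let ?U = "pmf_of_set (coord_pairs d)"
  have fin: "finite (set_pmf (replicate_pmf T ?U))"
    using d by (simp add: set_replicate_pmf finite_coord_pairs coord_pairs_nonempty
        finite_lists_length_eq lists_eq_set)
  have "replicate_pmf (Suc T) ?U = ?U \<bind> (\<lambda>p. map_pmf (Cons p) (replicate_pmf T ?U))"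
    by (simp add: map_pmf_def)
  then have "measure_pmf.expectation (replicate_pmf (Suc T) ?U) (\<lambda>ps. f (fold rot ps x))
      = (\<Sum>p\<in>coord_pairs d. measure_pmf.expectation (map_pmf (Cons p) (replicate_pmf T ?U))
          (\<lambda>ps. f (fold rot ps x)) /\<^sub>R real (card (coord_pairs d)))"
    using d fin
    by (simp only: pmf_expectation_bind_pmf_of_set coord_pairs_nonempty finite_coord_pairs
        set_map_pmf finite_imageI not_False_eq_True)
  also have "\<dots> = (\<Sum>p\<in>coord_pairs d. (avg d ^^ T) f (rot p x) / (real d * (real d - 1)))"
    using d by (intro sum.cong) (simp_all add: Suc card_coord_pairs of_nat_diff divide_simps)
  also have "\<dots> = (avg d ^^ Suc T) f x"
    by (simp add: avg_def sum_divide_distrib)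
  finally show ?case .
qed simp

text \<open>Union bound over the \<open>d^2\<close> entries.\<close>

lemma prob_max_abs_entry_le:
  assumes d: "d \<ge> 2"
    and tail: "\<And>k l. k < d \<Longrightarrow> l < d \<Longrightarrow> (avg d ^^ T) (\<lambda>x. of_bool (\<bar>x k\<bar> > b)) (basis_vec l) \<le> \<delta>"
  shows "measure_pmf.prob (ora_walk d T) {Q. max_abs_entry Q \<le> b} \<ge> 1 - (real d)\<^sup>2 * \<delta>"
proof -
  let ?M = "replicate_pmf T (pmf_of_set (coord_pairs d))"
  define bad where "bad kl = {ps. \<bar>fold rot ps (basis_vec (snd kl)) (fst kl)\<bar> > b}" for kl
  have "measure_pmf.prob ?M (bad kl) \<le> \<delta>" if "kl \<in> {..<d} \<times> {..<d}" for kl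
  proof -
    have "measure_pmf.prob ?M (bad kl) = measure_pmf.expectation ?M (indicator (bad kl))"
      by simp
    also have "indicator (bad kl) = (\<lambda>ps. of_bool (\<bar>fold rot ps (basis_vec (snd kl)) (fst kl)\<bar> > b) :: real)"
      by (auto simp: bad_def fun_eq_iff indicator_def)
    also have "measure_pmf.expectation ?M \<dots>
        = (avg d ^^ T) (\<lambda>x. of_bool (\<bar>x (fst kl)\<bar> > b)) (basis_vec (snd kl))"
      by (rule expectation_walk[OF d])
    also have "\<dots> \<le> \<delta>" using that by (intro tail) auto
    finally show ?thesis .
  qed
  then have "(\<Sum>kl\<in>{..<d} \<times> {..<d}. measure_pmf.prob ?M (bad kl)) \<le> (\<Sum>kl\<in>{..<d} \<times> {..<d}. \<delta>)"
    by (intro sum_mono)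
  moreover have "measure_pmf.prob ?M (\<Union>kl\<in>{..<d} \<times> {..<d}. bad kl)
      \<le> (\<Sum>kl\<in>{..<d} \<times> {..<d}. measure_pmf.prob ?M (bad kl))"
    by (intro measure_pmf.finite_measure_subadditive_finite) auto
  ultimately have union: "measure_pmf.prob ?M (\<Union>kl\<in>{..<d} \<times> {..<d}. bad kl) \<le> (real d)\<^sup>2 * \<delta>"
    by (simp add: power2_eq_square)
  have "max_abs_entry (ora_product d ps) \<le> b"
    if ps: "ps \<in> set_pmf ?M" and nb: "ps \<notin> (\<Union>kl\<in>{..<d} \<times> {..<d}. bad kl)" for ps
  proof -
    have sub: "set ps \<subseteq> coord_pairs d"
      using ps d by (auto simp: set_replicate_pmf finite_coord_pairs coord_pairs_nonempty lists_eq_set)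
    have "0 < d" using d by simp
    then have car: "ora_product d ps \<in> carrier_mat d d" using ora_product_entry(2)[OF sub] by blast
    let ?A = "{\<bar>ora_product d ps $$ (i, j)\<bar> | i j. i < d \<and> j < d}"
    have "?A = (\<lambda>(i, j). \<bar>ora_product d ps $$ (i, j)\<bar>) ` ({..<d} \<times> {..<d})" by auto
    then have "finite ?A" "?A \<noteq> {}" using \<open>0 < d\<close> by auto
    moreover have "a \<le> b" if "a \<in> ?A" for a
      using that nb ora_product_entry(1)[OF sub] by (force simp: bad_def not_less)
    ultimately have "Max ?A \<le> b" by (subst Max_le_iff) auto
    then show ?thesis using car by (simp add: max_abs_entry_def)
  qed
  \<comment> \<open>The inclusion is only almost sure: lists outside the support may contain pairs
    that are not valid coordinates.\<close>
  then have "measure_pmf.prob ?M (- (\<Union>kl\<in>{..<d} \<times> {..<d}. bad kl))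
      \<le> measure_pmf.prob ?M (ora_product d -` {Q. max_abs_entry Q \<le> b})"
    by (intro measure_pmf.finite_measure_mono_AE) (auto simp: AE_measure_pmf_iff)
  moreover have "measure_pmf.prob ?M (- (\<Union>kl\<in>{..<d} \<times> {..<d}. bad kl))
      = 1 - measure_pmf.prob ?M (\<Union>kl\<in>{..<d} \<times> {..<d}. bad kl)"
    using measure_pmf.prob_compl[of "\<Union>kl\<in>{..<d} \<times> {..<d}. bad kl" ?M] by (simp add: Compl_eq_Diff_UNIV)
  ultimately show ?thesis using union by (simp add: ora_walk_def)
qed

subsection \<open>The choice of parameters\<close>

lemma one_minus_power_le:
  assumes d: "d \<ge> 1" and a: "0 < a" "a \<le> 1" and n: "real m * real d * ln (real d) / a \<le> real n"
  shows "(1 - a / real d) ^ n \<le> 1 / real d ^ m"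
proof -
  have "1 - a / real d \<le> exp (- (a / real d))" using exp_ge_add_one_self[of "- (a / real d)"] by simp
  moreover have "0 \<le> 1 - a / real d" using d a by (simp add: field_simps)
  ultimately have "(1 - a / real d) ^ n \<le> exp (- (a / real d)) ^ n" by (intro power_mono)
  also have "\<dots> = exp (- (a * real n / real d))" by (simp add: exp_of_nat_mult[symmetric] field_simps)
  also have "\<dots> \<le> exp (- (real m * ln (real d)))"
    using n d a by (simp add: field_simps)
  also have "\<dots> = 1 / real d ^ m" using d by (simp add: exp_minus exp_of_nat_mult field_simps)
  finally show ?thesis .
qed

text \<open>Markov's inequality with \<open>p = 24\<close>: the moment is of order
  \<open>d ^ (- 23)\<close> and \<open>\<eta> ^ 24 = d ^ (- 15)\<close>. The exponent 5/8 lies above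
  1/2, so that \<open>d * ln d * \<eta>^2\<close> tends to 0, and below 1, so that high moments
  detect large coordinates.\<close>

lemma avg_pow_bad_small:
  "\<exists>K\<ge>0. \<forall>d \<tau> x t. d \<ge> 2 \<longrightarrow> (1 - 1 / real d) ^ \<tau> \<le> 1 / real d ^ 24 \<longrightarrow> x \<in> unit_sphere d
    \<longrightarrow> t \<ge> 23 * \<tau> \<longrightarrow>
    (avg d ^^ t) (\<lambda>x. of_bool (\<exists>i<d. (x i)\<^sup>2 > real d powr (- 5 / 8))) x \<le> K / real d ^ 8"
proof -
  obtain K where K: "K \<ge> 0" and decay: "\<And>d \<tau> x t. d \<ge> 2 \<Longrightarrow> (1 - 1 / real d) ^ \<tau> \<le> 1 / real d ^ 24
      \<Longrightarrow> x \<in> unit_sphere d \<Longrightarrow> t \<ge> 23 * \<tau> \<Longrightarrow> (avg d ^^ t) (power_sum d 24) x \<le> K / real d ^ 23"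
    using avg_pow_power_sum_decay[of 24 23] by auto
  have "(avg d ^^ t) (\<lambda>x. of_bool (\<exists>i<d. (x i)\<^sup>2 > real d powr (- 5 / 8))) x \<le> K / real d ^ 8"
    if d: "d \<ge> 2" and "(1 - 1 / real d) ^ \<tau> \<le> 1 / real d ^ 24" and x: "x \<in> unit_sphere d"
      and "t \<ge> 23 * \<tau>" for d \<tau> x t
  proof -
    define \<eta> where "\<eta> = real d powr (- 5 / 8)"
    have "\<eta> ^ 24 = real d powr (- 15)" using d by (simp add: \<eta>_def powr_power)
    also have "\<dots> = 1 / real d ^ 15" using d by (simp add: powr_minus powr_numeral field_simps)
    finally have \<eta>: "\<eta> ^ 24 = 1 / real d ^ 15" .
    have "(avg d ^^ t) (\<lambda>x. of_bool (\<exists>i<d. (x i)\<^sup>2 > \<eta>)) x \<le> (avg d ^^ t) (power_sum d 24) x / \<eta> ^ 24"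
      using d by (intro avg_pow_bad_le x) (auto simp: \<eta>_def)
    also have "\<dots> \<le> K / real d ^ 23 / \<eta> ^ 24"
      using decay[OF that] by (intro divide_right_mono) (auto simp: \<eta>_def)
    also have "\<dots> = K / real d ^ 8"
      using d by (simp add: \<eta> field_simps)
    finally show ?thesis by (simp add: \<eta>_def)
  qed
  then show ?thesis using K by blast
qed

lemma ora_entry_tail:
  "\<exists>d0. \<forall>d\<ge>d0. \<forall>T k l. real T \<ge> 1200 * real d * ln (real d) \<longrightarrow> k < d \<longrightarrow> l < d \<longrightarrow>
    (avg d ^^ T) (\<lambda>x. of_bool (\<bar>x k\<bar> > 8 * sqrt (ln (real d) / real d))) (basis_vec l) \<le> 1 / real d ^ 4"
proof -
  obtain K where K: "K \<ge> 0" and badK: "\<And>d \<tau> x t. d \<ge> 2 \<Longrightarrow> (1 - 1 / real d) ^ \<tau> \<le> 1 / real d ^ 24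
      \<Longrightarrow> x \<in> unit_sphere d \<Longrightarrow> t \<ge> 23 * \<tau>
      \<Longrightarrow> (avg d ^^ t) (\<lambda>x. of_bool (\<exists>i<d. (x i)\<^sup>2 > real d powr (- 5 / 8))) x \<le> K / real d ^ 8"
    using avg_pow_bad_small by blast
  \<comment> \<open>The four conditions on \<open>d\<close> serve, in turn, for flatness with
    \<open>\<theta> = d * ln d\<close>, for bounding step counts by \<open>d^2\<close>, for
    absorbing \<open>K\<close>, and for numerical estimates such as
    \<open>4 * d \<le> 9/2 * (d - 1)\<close>.\<close>
  have "\<forall>\<^sub>F d :: nat in sequentially. 36 * (real d * ln (real d)) * (real d powr (- 5 / 8))\<^sup>2 \<le> 1"
    by real_asymp
  moreover have "\<forall>\<^sub>F d :: nat in sequentially. 4 * (real d * ln (real d)) \<le> (real d)\<^sup>2"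
    by real_asymp
  moreover have "\<forall>\<^sub>F d :: nat in sequentially. real d \<ge> 2 + 2 * K"
    by real_asymp
  moreover have "\<forall>\<^sub>F d :: nat in sequentially. d \<ge> 9"
    by (rule eventually_ge_at_top)
  ultimately have "\<forall>\<^sub>F d :: nat in sequentially.
      36 * (real d * ln (real d)) * (real d powr (- 5 / 8))\<^sup>2 \<le> 1 \<and>
      4 * (real d * ln (real d)) \<le> (real d)\<^sup>2 \<and> real d \<ge> 2 + 2 * K \<and> d \<ge> 9"
    by eventually_elim auto
  then obtain d0 where d0: "\<And>d. d \<ge> d0 \<Longrightarrow>
      36 * (real d * ln (real d)) * (real d powr (- 5 / 8))\<^sup>2 \<le> 1 \<and>
      4 * (real d * ln (real d)) \<le> (real d)\<^sup>2 \<and> real d \<ge> 2 + 2 * K \<and> d \<ge> 9"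
    unfolding eventually_sequentially by blast
  have "(avg d ^^ T) (\<lambda>x. of_bool (\<bar>x k\<bar> > 8 * sqrt (ln (real d) / real d))) (basis_vec l) \<le> 1 / real d ^ 4"
    if "d \<ge> d0" and T: "real T \<ge> 1200 * real d * ln (real d)" and kl: "k < d" "l < d" for d T k l
  proof -
    define M where "M = real d * ln (real d)"
    have d: "d \<ge> 9" and flat: "36 * M * (real d powr (- 5 / 8))\<^sup>2 \<le> 1"
      and M2: "4 * M \<le> (real d)\<^sup>2" and dK: "real d \<ge> 2 + 2 * K"
      using d0[OF that(1)] by (auto simp: M_def)
    have "ln (real d) \<ge> 1"
    proof -
      have "exp 1 \<le> real d" using exp_le d by linarith
      then have "ln (exp 1) \<le> ln (real d)" using d by (subst ln_le_cancel_iff) auto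
      then show ?thesis by simp
    qed
    then have M: "M \<ge> 1" using d mult_mono[of 1 "real d" 1 "ln (real d)"] by (simp add: M_def)
    \<comment> \<open>\<open>n\<close> needs at least \<open>8/3 * M\<close> for contraction by
      \<open>d ^ (- 2)\<close> at rate \<open>3 / (4 * d)\<close>, and \<open>\<tau>\<close> needs
      \<open>24 * M\<close> for \<open>d ^ (- 24)\<close> at rate \<open>1 / d\<close>. Then
      \<open>2 * (23 * \<tau> + n)\<close> is at most \<open>1110 * M + 48\<close>, whence the
      constant 1200.\<close>
    define n where "n = nat \<lceil>3 * M\<rceil>"
    define \<tau> where "\<tau> = nat \<lceil>24 * M\<rceil>"
    have n: "3 * M \<le> real n" "real n \<le> 3 * M + 1"
      and tau: "24 * M \<le> real \<tau>" "real \<tau> \<le> 24 * M + 1"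
    proof -
      have "real n = of_int \<lceil>3 * M\<rceil>" "real \<tau> = of_int \<lceil>24 * M\<rceil>"
        using M by (auto simp: n_def \<tau>_def)
      then show "3 * M \<le> real n" "real n \<le> 3 * M + 1" "24 * M \<le> real \<tau>" "real \<tau> \<le> 24 * M + 1"
        by linarith+
    qed
    \<comment> \<open>With \<open>d - 1\<close> replaced by \<open>d\<close>, this \<open>c\<close>
      minimises the exponent \<open>- c * b + 2 * c^2 / d\<close>, giving
      \<open>- 8 * ln d\<close>.\<close>
    define c where "c = 2 * sqrt M"
    define b where "b = 8 * sqrt (ln (real d) / real d)"
    have c2: "c\<^sup>2 = 4 * M" using M by (simp add: c_def power_mult_distrib)
    have cb: "c * b = 16 * ln (real d)"
    proof -
      have "c * b = 16 * sqrt (M * (ln (real d) / real d))" 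
        unfolding c_def b_def real_sqrt_mult by simp
      also have "M * (ln (real d) / real d) = (ln (real d))\<^sup>2"
        using d by (simp add: M_def power2_eq_square)
      finally show ?thesis using \<open>ln (real d) \<ge> 1\<close> by simp
    qed
    have "(avg d ^^ T) (\<lambda>x. of_bool (\<bar>x k\<bar> > b)) (basis_vec l)
        \<le> 2 * exp (- c * b) * (exp (1 + c\<^sup>2 / (real d - 1)))\<^sup>2 + 2 * real n * (K / real d ^ 8)"
    proof (rule entry_tail[where \<eta> = "real d powr (- 5 / 8)" and ?t0.0 = "23 * \<tau>"])
      show "c\<^sup>2 / 4 * (1 - 3 / (4 * real d)) ^ n \<le> 1"
      proof -
        have "(1 - 3 / 4 / real d) ^ n \<le> 1 / real d ^ 2"
          by (rule one_minus_power_le) (use d n M in \<open>auto simp: M_def\<close>)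
        then have "M * (1 - 3 / 4 / real d) ^ n \<le> (real d)\<^sup>2 * (1 / real d ^ 2)"
          using M M2 d by (intro mult_mono zero_le_power) (auto simp: field_simps)
        also have "\<dots> = 1" using d by simp
        finally show ?thesis by (simp add: c2)
      qed
      show "(avg d ^^ t) (\<lambda>x. of_bool (\<exists>i<d. (x i)\<^sup>2 > real d powr (- 5 / 8))) x \<le> K / real d ^ 8"
        if "t \<ge> 23 * \<tau>" "x \<in> unit_sphere d" for t x
      proof (rule badK[OF _ _ that(2,1)])
        show "(1 - 1 / real d) ^ \<tau> \<le> 1 / real d ^ 24"
          by (rule one_minus_power_le) (use d tau in \<open>auto simp: M_def\<close>)
      qed (use d in auto)
      have "real (2 * (23 * \<tau> + n)) \<le> real T"
        using T n tau M by (simp add: M_def)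
      then show "T \<ge> 2 * (23 * \<tau> + n)" by (simp only: of_nat_le_iff)
    qed (use d kl K M flat in \<open>auto simp: c2 algebra_simps c_def\<close>)
    also have "2 * exp (- c * b) * (exp (1 + c\<^sup>2 / (real d - 1)))\<^sup>2 \<le> 18 / real d ^ 7"
    proof -
      \<comment> \<open>Using 9/2 instead of 4 pays for \<open>d - 1\<close> in the denominator; the
        exponent becomes \<open>- 16 + 2 * 9/2 = - 7\<close> times \<open>ln d\<close>.\<close>
      have "c\<^sup>2 / (real d - 1) \<le> 9 / 2 * ln (real d)"
      proof -
        have "4 * real d \<le> 9 / 2 * (real d - 1)" using d by simp
        then have "4 * real d * ln (real d) \<le> 9 / 2 * (real d - 1) * ln (real d)"
          using \<open>ln (real d) \<ge> 1\<close> by (intro mult_right_mono) auto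
        then show ?thesis using d by (simp add: c2 M_def field_simps)
      qed
      then have "exp (1 + c\<^sup>2 / (real d - 1)) \<le> exp (1 + 9 / 2 * ln (real d))" by simp
      then have "(exp (1 + c\<^sup>2 / (real d - 1)))\<^sup>2 \<le> (exp (1 + 9 / 2 * ln (real d)))\<^sup>2"
        by (intro power_mono) auto
      then have "2 * exp (- c * b) * (exp (1 + c\<^sup>2 / (real d - 1)))\<^sup>2
          \<le> 2 * exp (- 16 * ln (real d)) * (exp (1 + 9 / 2 * ln (real d)))\<^sup>2"
        using cb by simp
      also have "\<dots> = 2 * (exp 1)\<^sup>2 * exp (- (real 7 * ln (real d)))"
        by (simp add: power2_eq_square flip: exp_add)
      also have "exp (- (real 7 * ln (real d))) = 1 / real d ^ 7"
        using d unfolding exp_minus exp_of_nat_mult by (simp add: field_simps)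
      also have "2 * (exp 1)\<^sup>2 * (1 / real d ^ 7) \<le> 2 * 3\<^sup>2 * (1 / real d ^ 7)"
        using exp_le by (intro mult_left_mono mult_right_mono power_mono) auto
      finally show ?thesis by simp
    qed
    also have "2 * real n * (K / real d ^ 8) \<le> 2 * K / real d ^ 6"
    proof -
      have "real n \<le> (real d)\<^sup>2" using n M M2 by linarith
      then have "2 * real n * (K / real d ^ 8) \<le> 2 * (real d)\<^sup>2 * (K / real d ^ 8)"
        using K by (intro mult_right_mono mult_left_mono) auto
      also have "\<dots> = 2 * K / real d ^ 6"
        using d by (simp add: field_simps)
      finally show ?thesis .
    qed
    also have "18 / real d ^ 7 + 2 * K / real d ^ 6 \<le> 1 / real d ^ 4"
    proof -
      have "18 + 2 * K * real d \<le> real d ^ 3"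
      proof -
        have "18 + 2 * K * real d \<le> (2 + 2 * K) * real d" using d by (simp add: algebra_simps)
        also have "\<dots> \<le> real d * real d" using dK by (intro mult_right_mono) auto
        also have "\<dots> \<le> real d * real d * real d" using d by simp
        finally show ?thesis by (simp add: power3_eq_cube)
      qed
      then have "(18 + 2 * K * real d) / real d ^ 7 \<le> real d ^ 3 / real d ^ 7"
        by (intro divide_right_mono) auto
      moreover have "(18 + 2 * K * real d) / real d ^ 7 = 18 / real d ^ 7 + 2 * K / real d ^ 6"
        "real d ^ 3 / real d ^ 7 = 1 / real d ^ 4"
        using d by (simp_all add: field_simps flip: power_Suc)
      ultimately show ?thesis by simp
    qed
    finally show ?thesis by (simp add: b_def)
  qed
  then show ?thesis by blast
qed

theorem theorem1p1:
  shows "\<exists>(C::real) (d0::nat). C > 0 \<and>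
    (\<forall>d\<ge>d0. \<forall>T::nat. real T \<ge> C * real d * ln (real d) \<longrightarrow>
      measure_pmf.prob (ora_walk d T)
          {Q. max_abs_entry Q \<le> 8 * sqrt (ln (real d) / real d)}
        \<ge> 1 - 1 / (real d)\<^sup>2)"
proof -
  obtain d0 where d0: "\<And>d T k l. d \<ge> d0 \<Longrightarrow> real T \<ge> 1200 * real d * ln (real d) \<Longrightarrow> k < d \<Longrightarrow> l < d
      \<Longrightarrow> (avg d ^^ T) (\<lambda>x. of_bool (\<bar>x k\<bar> > 8 * sqrt (ln (real d) / real d))) (basis_vec l)
        \<le> 1 / real d ^ 4"
    using ora_entry_tail by blast
  have "measure_pmf.prob (ora_walk d T) {Q. max_abs_entry Q \<le> 8 * sqrt (ln (real d) / real d)}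
      \<ge> 1 - 1 / (real d)\<^sup>2"
    if d: "d \<ge> max 2 d0" and T: "real T \<ge> 1200 * real d * ln (real d)" for d T
  proof -
    \<comment> \<open>Each of the \<open>d^2\<close> entries fails with probability at most
      \<open>d ^ (- 4)\<close>.\<close>
    have "(real d)\<^sup>2 * (1 / real d ^ 4) = 1 / (real d)\<^sup>2" using d by (simp add: field_simps)
    then show ?thesis
      using prob_max_abs_entry_le[of d T "8 * sqrt (ln (real d) / real d)" "1 / real d ^ 4"] d0 d T
      by simp
  qed
  then show ?thesis by (intro exI[of _ 1200] exI[of _ "max 2 d0"]) auto
qed

end
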